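(* Let $H$ be an $r$-uniform hypergraph and let $\alpha$ and $A$ be positive constants. Suppose that $\alpha > r-1/m_r(H)$ and that $\mathrm{ex}(n,H)\le A n^{\alpha}$ for all $n$. Then there exists a constant $C$ depending only on $\alpha$, $A$, and $H$ such that for all $n$, \[ |\mathcal{F}_n(H)| \le 2^{C n^{\alpha}}. \]
   Context: For an $r$-uniform hypergraph $H$, $\mathrm{ex}(n,H)$ is the maximum number of edges in an $n$-vertex $r$-uniform hypergraph not containing $H$ as a (not necessarily induced) subhypergraph, and $\mathcal{F}_n(H)$ is the set of all labeled $H$-free $r$-uniform hypergraphs on vertex set $[n]$. The $r$-density of $H$ is $m_r(H)=\max\{\frac{e_F-1}{v_F-r} : F\subseteq H,\ v_F>r\}$, where $v_F,e_F$ are the numbers of vertices and edges of $F$. *)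

theory Defs
  imports Complex_Main "HOL-Library.Extended_Real"
begin

text \<open>A hypergraph is a pair of a vertex set and an edge set; isolated vertices are allowed.\<close>

type_synonym 'a hypergraph = "'a set \<times> 'a set set"

abbreviation verts :: "'a hypergraph \<Rightarrow> 'a set" where "verts \<equiv> fst"

abbreviation edges :: "'a hypergraph \<Rightarrow> 'a set set" where "edges \<equiv> snd"

definition uniform_hypergraph :: "nat \<Rightarrow> 'a hypergraph \<Rightarrow> bool" where
  "uniform_hypergraph r H \<longleftrightarrow>
     finite (verts H) \<and> (\<forall>e \<in> edges H. e \<subseteq> verts H \<and> card e = r)"

definition subhypergraph :: "'a hypergraph \<Rightarrow> 'a hypergraph \<Rightarrow> bool" where
  "subhypergraph F H \<longleftrightarrow>
     verts F \<subseteq> verts H \<and> edges F \<subseteq> edges H \<and> (\<forall>e \<in> edges F. e \<subseteq> verts F)"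

text \<open>\<open>contains_copy G H\<close>: some subhypergraph of \<open>G\<close>, not necessarily induced, is
  isomorphic to \<open>H\<close>.\<close>

definition contains_copy :: "'b hypergraph \<Rightarrow> 'a hypergraph \<Rightarrow> bool" where
  "contains_copy G H \<longleftrightarrow>
     (\<exists>f. inj_on f (verts H) \<and> f ` verts H \<subseteq> verts G \<and> (\<forall>e \<in> edges H. f ` e \<in> edges G))"

text \<open>The maximum is written as a supremum in \<open>nat\<close>, which is the maximum of a nonempty
  bounded set and \<open>0\<close> for the empty set; the latter occurs only if \<open>H\<close> has no edges.\<close>

definition ex_num :: "nat \<Rightarrow> nat \<Rightarrow> 'a hypergraph \<Rightarrow> nat" where
  "ex_num r n H =
     Sup {card (edges G) | G :: nat hypergraph.
            uniform_hypergraph r G \<and> card (verts G) = n \<and> \<not> contains_copy G H}"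

definition free_hypergraphs :: "nat \<Rightarrow> nat \<Rightarrow> 'a hypergraph \<Rightarrow> nat hypergraph set" where
  "free_hypergraphs r n H =
     {G. uniform_hypergraph r G \<and> verts G = {1..n} \<and> \<not> contains_copy G H}"

text \<open>If \<open>H\<close> has at most \<open>r\<close> vertices, hence at most one edge, then no \<open>F\<close> is admissible in
  the maximum, and the value is set to \<open>0\<close>.
  The bound \<open>r - 1 / r_density r H\<close> is meant in the extended reals, where \<open>1 / 0 = \<infinity>\<close>, so
  density \<open>0\<close> leaves the exponent unrestricted.\<close>

definition r_density :: "nat \<Rightarrow> 'a hypergraph \<Rightarrow> real" where
  "r_density r H =
     (if card (verts H) \<le> r then 0
      else Max {(real (card (edges F)) - 1) / (real (card (verts F)) - real r) | F.
                  subhypergraph F H \<and> card (verts F) > r})"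

lemma finite_free_hypergraphs: "finite (free_hypergraphs r n H)"
proof (rule finite_subset)
  show "free_hypergraphs r n H \<subseteq> {{1..n}} \<times> Pow (Pow {1..n})"
    by (force simp: free_hypergraphs_def uniform_hypergraph_def)
qed simp

lemma finite_subhypergraphs:
  assumes "uniform_hypergraph r H"
  shows "finite {F. subhypergraph F H}"
proof (rule finite_subset)
  show "{F. subhypergraph F H} \<subseteq> Pow (verts H) \<times> Pow (Pow (verts H))"
    using assms by (force simp: subhypergraph_def uniform_hypergraph_def)
  show "finite (Pow (verts H) \<times> Pow (Pow (verts H)))"
    using assms by (simp add: uniform_hypergraph_def)
qed

lemma bdd_above_ex_num:
  "bdd_above {card (edges G) | G :: nat hypergraph.
            uniform_hypergraph r G \<and> card (verts G) = n \<and> \<not> contains_copy G H}"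
proof (rule bdd_aboveI[where M = "2 ^ n"], clarify)
  fix V :: "nat set" and E
  assume "uniform_hypergraph r (V, E)"
  then have "finite V" "E \<subseteq> Pow V" by (auto simp: uniform_hypergraph_def)
  then show "card (edges (V, E)) \<le> 2 ^ card (verts (V, E))"
    by (metis card_Pow card_mono finite_Pow_iff fst_conv snd_conv)
qed

end

theory Submission
  imports Defs
begin

text \<open>Let \<open>G\<close> have \<open>k n^\<alpha>\<close> edges. In each vertex set \<open>W\<close> of size \<open>m = \<Theta>(n k^(-1/(r-\<alpha>)))\<close> fix a maximal
  edge-disjoint family of copies of \<open>H\<close>; the bound on \<open>ex(m,H)\<close> makes it cover half of the edges of
  \<open>G[W]\<close> on average. Averaging over \<open>W\<close> gives a weight on the copies of \<open>H\<close> in \<open>G\<close>. By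
  edge-disjointness a set \<open>T\<close> of edges lies in at most one chosen copy per \<open>W\<close>, and only if \<open>W\<close>
  contains all vertices of \<open>T\<close>; since \<open>T\<close> spans at least \<open>r + (|T|-1)/m_r(H)\<close> vertices, its
  relative degree is at most \<open>\<tau>^(|T|-1)\<close> with \<open>\<tau> = (m/n)^(1/m_r(H)) = O(k^(-\<rho>))\<close>. The hypothesis
  \<open>\<alpha> > r - 1/m_r(H)\<close> says exactly that \<open>\<rho> = 1/((r-\<alpha>) m_r(H)) > 1\<close>. So the container lemma
  covers the \<open>H\<close>-free subgraphs of \<open>G\<close> by \<open>exp(O(n^\<alpha> k^(-\<gamma>)))\<close> sets, \<open>\<gamma> > 0\<close>, each smaller than
  \<open>G\<close> by a constant factor, and the exponents accumulated from \<open>k = n^(r-\<alpha>)\<close> down to constant \<open>k\<close>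
  form a geometric series.\<close>

section \<open>Hypergraph containers\<close>

text \<open>The weighted hypergraph on \<open>V\<close> has the subsets of \<open>V\<close> in the
  support of \<open>w\<close> as edges; \<open>T = {}\<close> gives its total weight.\<close>

definition wdeg :: "'e set \<Rightarrow> ('e set \<Rightarrow> real) \<Rightarrow> 'e set \<Rightarrow> real" where
  "wdeg V w T = (\<Sum>e | e \<subseteq> V \<and> T \<subseteq> e. w e)"

text \<open>Weights are scaled so that vertex degrees are at most \<open>1\<close>; the usual codegree condition
  \<open>\<Delta>\<^sub>t \<le> K \<tau>^(t-1) e(w) / |V|\<close> then needs no reference to the total weight.\<close>

definition balanced :: "'e set \<Rightarrow> nat \<Rightarrow> real \<Rightarrow> real \<Rightarrow> ('e set \<Rightarrow> real) \<Rightarrow> bool" where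
  "balanced V h c \<tau> w \<longleftrightarrow>
     (\<forall>e. 0 \<le> w e) \<and> (\<forall>e\<subseteq>V. w e \<noteq> 0 \<longrightarrow> card e = h) \<and>
     (\<forall>T\<subseteq>V. T \<noteq> {} \<longrightarrow> wdeg V w T \<le> \<tau> ^ (card T - 1)) \<and>
     c * real (card V) \<le> wdeg V w {}"

definition small_sets :: "'e set \<Rightarrow> real \<Rightarrow> 'e set set" where
  "small_sets V x = {S. S \<subseteq> V \<and> real (card S) \<le> x}"

text \<open>A set on all of whose subsets \<open>w\<close> vanishes is an independent set of the
  weighted hypergraph.\<close>

definition container_family ::
    "'e set \<Rightarrow> ('e set \<Rightarrow> real) \<Rightarrow> real \<Rightarrow> 'e set set \<Rightarrow> bool" where
  "container_family V w \<delta> \<C> \<longleftrightarrow>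
     (\<forall>C\<in>\<C>. C \<subseteq> V \<and> real (card C) \<le> (1 - \<delta>) * real (card V)) \<and>
     (\<forall>I\<subseteq>V. (\<forall>e\<subseteq>I. w e = 0) \<longrightarrow> (\<exists>C\<in>\<C>. I \<subseteq> C))"

section \<open>Weighted degrees and containers in uniformity one\<close>

lemma finite_restricted_Pow [simp]: "finite V \<Longrightarrow> finite {e. e \<subseteq> V \<and> P e}"
  by (rule finite_subset[of _ "Pow V"]) auto

lemma balancedD:
  assumes "balanced V h c \<tau> w"
  shows "0 \<le> w e" "e \<subseteq> V \<Longrightarrow> w e \<noteq> 0 \<Longrightarrow> card e = h"
    "T \<subseteq> V \<Longrightarrow> T \<noteq> {} \<Longrightarrow> wdeg V w T \<le> \<tau> ^ (card T - 1)"
    "c * real (card V) \<le> wdeg V w {}"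
  using assms unfolding balanced_def by auto

lemma wdeg_nonneg: "(\<And>e. 0 \<le> w e) \<Longrightarrow> 0 \<le> wdeg V w T"
  by (simp add: wdeg_def sum_nonneg)

lemma wdeg_add: "wdeg V (\<lambda>e. w e + w' e) T = wdeg V w T + wdeg V w' T"
  by (simp add: wdeg_def sum.distrib)

lemma wdeg_scale: "wdeg V (\<lambda>e. x * w e) T = x * wdeg V w T"
  by (simp add: wdeg_def sum_distrib_left)

lemma wdeg_eq_sum_Pow: "finite V \<Longrightarrow> wdeg V w T = (\<Sum>e\<in>Pow V. if T \<subseteq> e then w e else 0)"
  unfolding wdeg_def by (subst sum.inter_filter[symmetric]) (auto intro: sum.cong)

text \<open>Double counting: an edge of size \<open>h\<close> is counted once for each of its
  \<open>2 ^ h\<close> subsets.\<close>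

lemma sum_wdeg_uniform:
  assumes "finite V" "\<And>e. e \<subseteq> V \<Longrightarrow> w e \<noteq> 0 \<Longrightarrow> card e = h"
  shows "(\<Sum>T\<in>Pow V. wdeg V w T) = 2 ^ h * wdeg V w {}"
proof -
  have "(\<Sum>T\<in>Pow V. wdeg V w T) = (\<Sum>T\<in>Pow V. \<Sum>e\<in>Pow V. if T \<subseteq> e then w e else 0)"
    using assms(1) by (simp add: wdeg_eq_sum_Pow)
  also have "\<dots> = (\<Sum>e\<in>Pow V. \<Sum>T\<in>Pow V. if T \<subseteq> e then w e else 0)"
    by (rule sum.swap)
  also have "\<dots> = (\<Sum>e\<in>Pow V. 2 ^ h * w e)"
  proof (rule sum.cong[OF refl])
    fix e assume e: "e \<in> Pow V"
    then have fe: "finite e" using assms(1) finite_subset by auto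
    have "{T \<in> Pow V. T \<subseteq> e} = Pow e" using e by auto
    then have "(\<Sum>T\<in>Pow V. if T \<subseteq> e then w e else 0) = real (card (Pow e)) * w e"
      using assms(1) by (simp add: sum.inter_filter[symmetric])
    also have "\<dots> = 2 ^ h * w e"
      using assms(2)[of e] e fe by (cases "w e = 0") (auto simp: card_Pow)
    finally show "(\<Sum>T\<in>Pow V. if T \<subseteq> e then w e else 0) = 2 ^ h * w e" .
  qed
  also have "\<dots> = 2 ^ h * wdeg V w {}"
    by (simp add: wdeg_def sum_distrib_left Pow_def)
  finally show ?thesis .
qed

text \<open>An independent set avoids all vertices whose singleton has positive weight. Degrees are
  at most \<open>1\<close>, so there are at least \<open>c * card V\<close> such vertices, and their
  complement is a single container for all independent sets.\<close>

lemma container_uniformity_one: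
  assumes "finite V" "balanced V 1 c \<tau> w"
  shows "container_family V w c {{v\<in>V. w {v} = 0}}"
proof -
  have le1: "w {v} \<le> 1" if "v \<in> V" for v
  proof -
    have "w {v} \<le> wdeg V w {v}"
      unfolding wdeg_def using assms that
      by (intro member_le_sum) (auto simp: balanced_def)
    also have "\<dots> \<le> \<tau> ^ (card {v} - 1)" using balancedD(3)[OF assms(2)] that by blast
    finally show ?thesis by simp
  qed
  have "c * real (card V) \<le> wdeg V w {}" using assms by (simp add: balanced_def)
  also have "\<dots> = (\<Sum>e\<in>(\<lambda>v. {v}) ` V. w e)"
    unfolding wdeg_def
  proof (rule sum.mono_neutral_right)
    show "\<forall>e\<in>{e. e \<subseteq> V \<and> {} \<subseteq> e} - (\<lambda>v. {v}) ` V. w e = 0"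
    proof
      fix e assume e: "e \<in> {e. e \<subseteq> V \<and> {} \<subseteq> e} - (\<lambda>v. {v}) ` V"
      then have "card e \<noteq> 1" by (auto simp: card_1_singleton_iff)
      then show "w e = 0" using assms(2) e by (auto simp: balanced_def)
    qed
  qed (use assms in auto)
  also have "\<dots> = (\<Sum>v\<in>V. w {v})" by (subst sum.reindex) auto
  also have "\<dots> \<le> (\<Sum>v\<in>V. if w {v} = 0 then 0 else 1)"
    by (rule sum_mono) (use le1 in auto)
  also have "\<dots> = real (card (V - {v\<in>V. w {v} = 0}))"
    using assms(1) by (simp add: sum.If_cases set_diff_eq Int_def conj_commute cong: conj_cong)
  also have "\<dots> = real (card V) - real (card {v\<in>V. w {v} = 0})"
    using assms(1) by (subst card_Diff_subset) (auto intro: card_mono of_nat_diff)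
  finally show ?thesis
    by (auto simp: container_family_def algebra_simps)
qed

section \<open>Traces of fingerprints\<close>

text \<open>One link adds at most \<open>\<tau> ^ card T\<close> to the degree of \<open>T\<close>,
  so ignoring \<open>T\<close> once its degree exceeds \<open>M * \<tau> ^ card T\<close> keeps this
  degree at most \<open>(M + 1) * \<tau> ^ card T\<close>.\<close>

definition saturated :: "'e set \<Rightarrow> real \<Rightarrow> real \<Rightarrow> ('e set \<Rightarrow> real) \<Rightarrow> 'e set set" where
  "saturated V \<tau> M w' = {T. T \<subseteq> V \<and> T \<noteq> {} \<and> M * \<tau> ^ card T < wdeg V w' T}"

definition link ::
    "'e set \<Rightarrow> ('e set \<Rightarrow> real) \<Rightarrow> real \<Rightarrow> real \<Rightarrow> ('e set \<Rightarrow> real) \<Rightarrow> 'e \<Rightarrow> 'e set \<Rightarrow> real" where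
  "link V w \<tau> M w' v f =
     (if v \<notin> f \<and> (\<forall>T\<in>saturated V \<tau> M w'. \<not> T \<subseteq> f) then w (insert v f) else 0)"

text \<open>\<open>trace_of V h w \<tau> M \<beta> S w'\<close>: the \<open>h\<close>-uniform weight \<open>w'\<close> can arise by adding up, vertex by vertex,
  the links in \<open>w\<close> of the vertices of \<open>S\<close>, where sets containing a saturated set are discarded and
  each link contributes weight at least \<open>\<beta>\<close>. Only the properties needed later are recorded, not
  the order in which the vertices were taken.\<close>

definition trace_of ::
    "'e set \<Rightarrow> nat \<Rightarrow> ('e set \<Rightarrow> real) \<Rightarrow> real \<Rightarrow> real \<Rightarrow> real \<Rightarrow> 'e set \<Rightarrow> ('e set \<Rightarrow> real) \<Rightarrow> bool" where
  "trace_of V h w \<tau> M \<beta> S w' \<longleftrightarrow>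
     S \<subseteq> V \<and> (\<forall>f. 0 \<le> w' f) \<and>
     (\<forall>f\<subseteq>V. w' f \<noteq> 0 \<longrightarrow> card f = h \<and> (\<exists>v\<in>S. v \<notin> f \<and> w (insert v f) \<noteq> 0)) \<and>
     (\<forall>T\<subseteq>V. T \<noteq> {} \<longrightarrow> wdeg V w' T \<le> (M + 1) * \<tau> ^ card T) \<and>
     \<beta> * real (card S) \<le> wdeg V w' {} \<and> wdeg V w' {} \<le> real (card S)"

lemma trace_ofD:
  assumes "trace_of V h w \<tau> M \<beta> S w'"
  shows "S \<subseteq> V" "0 \<le> w' f" "f \<subseteq> V \<Longrightarrow> w' f \<noteq> 0 \<Longrightarrow> card f = h"
    "f \<subseteq> V \<Longrightarrow> w' f \<noteq> 0 \<Longrightarrow> \<exists>v\<in>S. v \<notin> f \<and> w (insert v f) \<noteq> 0"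
    "T \<subseteq> V \<Longrightarrow> T \<noteq> {} \<Longrightarrow> wdeg V w' T \<le> (M + 1) * \<tau> ^ card T"
    "\<beta> * real (card S) \<le> wdeg V w' {}" "wdeg V w' {} \<le> real (card S)"
  using assms unfolding trace_of_def by auto

lemma link_nonneg: "(\<And>e. 0 \<le> w e) \<Longrightarrow> 0 \<le> link V w \<tau> M w' v f"
  by (simp add: link_def)

text \<open>Adding \<open>v\<close> back to a set of the link is injective and produces an edge
  through \<open>v\<close>.\<close>

lemma wdeg_link_le:
  assumes "finite V" "\<And>e. 0 \<le> w e" "v \<in> V"
  shows "wdeg V (link V w \<tau> M w' v) T \<le> wdeg V w (insert v T)"
proof -
  have "wdeg V (link V w \<tau> M w' v) T
      \<le> (\<Sum>f | f \<subseteq> V \<and> T \<subseteq> f. if v \<notin> f then w (insert v f) else 0)"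
    unfolding wdeg_def by (rule sum_mono) (auto simp: link_def assms)
  also have "\<dots> = (\<Sum>f | f \<subseteq> V \<and> T \<subseteq> f \<and> v \<notin> f. w (insert v f))"
    using assms(1) by (simp add: sum.If_cases Int_def conj_ac)
  also have "\<dots> = (\<Sum>e\<in>insert v ` {f. f \<subseteq> V \<and> T \<subseteq> f \<and> v \<notin> f}. w e)"
    by (subst sum.reindex) (auto simp: inj_on_def)
  also have "\<dots> \<le> wdeg V w (insert v T)"
    unfolding wdeg_def using assms by (intro sum_mono2) auto
  finally show ?thesis .
qed

lemma wdeg_link_le_power:
  assumes "finite V" "balanced V k c \<tau> w" "v \<in> V" "T \<subseteq> V" "0 \<le> \<tau>"
  shows "wdeg V (link V w \<tau> M w' v) T \<le> \<tau> ^ card T"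
proof (cases "v \<in> T")
  case True
  then have "wdeg V (link V w \<tau> M w' v) T = 0"
    unfolding wdeg_def by (intro sum.neutral) (auto simp: link_def)
  then show ?thesis using assms by simp
next
  case False
  have fin: "finite T" using assms finite_subset by blast
  have "wdeg V (link V w \<tau> M w' v) T \<le> wdeg V w (insert v T)"
    using assms by (intro wdeg_link_le) (auto simp: balanced_def)
  also have "\<dots> \<le> \<tau> ^ (card (insert v T) - 1)"
    using balancedD(3)[OF assms(2)] assms(3,4) by simp
  finally show ?thesis using False fin by simp
qed

text \<open>A saturated \<open>T\<close> gains nothing from the new link; any other \<open>T\<close>
  gains at most \<open>\<tau> ^ card T\<close> on top of \<open>M * \<tau> ^ card T\<close>. The
  total weight grows by at least \<open>\<beta>\<close> by \<open>res\<close>, and by at most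
  \<open>1\<close> because that bounds the degree of \<open>v\<close>.\<close>

lemma trace_of_insert:
  assumes fin: "finite V" and bal: "balanced V (Suc h) c \<tau> w" and "0 \<le> \<tau>" "0 \<le> M"
    and tr: "trace_of V h w \<tau> M \<beta> S w'" and v: "v \<in> V" "v \<notin> S"
    and res: "\<beta> \<le> wdeg V (link V w \<tau> M w' v) {}"
  shows "trace_of V h w \<tau> M \<beta> (insert v S) (\<lambda>f. w' f + link V w \<tau> M w' v f)"
proof -
  let ?l = "link V w \<tau> M w' v"
  have w0: "0 \<le> w e" for e using bal by (simp add: balanced_def)
  have finS: "finite S" using trace_ofD(1)[OF tr] fin finite_subset by blast
  have supp: "card f = h \<and> (\<exists>u\<in>insert v S. u \<notin> f \<and> w (insert u f) \<noteq> 0)"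
    if f: "f \<subseteq> V" "w' f + ?l f \<noteq> 0" for f
  proof (cases "w' f = 0")
    case True
    then have l: "v \<notin> f" "w (insert v f) \<noteq> 0" using f by (auto simp: link_def split: if_splits)
    then have "card (insert v f) = Suc h" using balancedD(2)[OF bal] f v by simp
    moreover have "finite f" using f fin finite_subset by blast
    ultimately show ?thesis using l by auto
  next
    case False
    then show ?thesis using trace_ofD(3,4)[OF tr f(1)] by blast
  qed
  have deg: "wdeg V w' T + wdeg V ?l T \<le> (M + 1) * \<tau> ^ card T"
    if T: "T \<subseteq> V" "T \<noteq> {}" for T
  proof (cases "T \<in> saturated V \<tau> M w'")
    case True
    then have "wdeg V ?l T = 0"
      unfolding wdeg_def by (intro sum.neutral) (auto simp: link_def)
    then show ?thesis using tr T by (simp add: trace_of_def)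
  next
    case False
    then have "wdeg V w' T \<le> M * \<tau> ^ card T" using T by (auto simp: saturated_def)
    moreover have "wdeg V ?l T \<le> \<tau> ^ card T"
      using wdeg_link_le_power[OF fin bal v(1) T(1)] assms(3) by simp
    ultimately show ?thesis by (simp add: algebra_simps)
  qed
  have tot: "wdeg V ?l {} \<le> 1"
    using wdeg_link_le_power[OF fin bal v(1), of "{}" M w'] assms(3) by simp
  show ?thesis
    unfolding trace_of_def wdeg_add
  proof (intro conjI)
    show "insert v S \<subseteq> V" using tr v by (simp add: trace_of_def)
    show "\<forall>f. 0 \<le> w' f + ?l f" using tr link_nonneg[of w] w0 by (simp add: trace_of_def)
    show "\<forall>f\<subseteq>V. w' f + ?l f \<noteq> 0 \<longrightarrow>
        card f = h \<and> (\<exists>u\<in>insert v S. u \<notin> f \<and> w (insert u f) \<noteq> 0)"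
      using supp by blast
    show "\<forall>T\<subseteq>V. T \<noteq> {} \<longrightarrow> wdeg V w' T + wdeg V ?l T \<le> (M + 1) * \<tau> ^ card T"
      using deg by blast
    show "\<beta> * real (card (insert v S)) \<le> wdeg V w' {} + wdeg V ?l {}"
      using tr res v finS by (simp add: trace_of_def algebra_simps)
    show "wdeg V w' {} + wdeg V ?l {} \<le> real (card (insert v S))"
      using tr tot v finS by (simp add: trace_of_def)
  qed
qed

text \<open>For saturated \<open>T\<close> the degree in \<open>w\<close> is at most
  \<open>wdeg V w' T / (M * \<tau>)\<close>. Summing the degrees of \<open>w'\<close> over all
  \<open>T\<close> gives \<open>2 ^ h\<close> times its total weight, which is at most
  \<open>card S\<close> and hence at most \<open>\<tau> * card V\<close>.\<close>

lemma weight_of_saturated_edges: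
  assumes fin: "finite V" and bal: "balanced V (Suc h) c \<tau> w" and "0 < \<tau>" "0 < M"
    and tr: "trace_of V h w \<tau> M \<beta> S w'" and S: "real (card S) \<le> \<tau> * real (card V)"
  shows "(\<Sum>e | e \<subseteq> V \<and> (\<exists>T\<in>saturated V \<tau> M w'. T \<subseteq> e). w e) \<le> 2 ^ h / M * real (card V)"
proof -
  let ?Sat = "saturated V \<tau> M w'"
  have w0: "0 \<le> w e" for e using bal by (simp add: balanced_def)
  have finSat: "finite ?Sat" using fin by (auto simp: saturated_def)
  have "(\<Sum>e | e \<subseteq> V \<and> (\<exists>T\<in>?Sat. T \<subseteq> e). w e)
      \<le> (\<Sum>e | e \<subseteq> V \<and> (\<exists>T\<in>?Sat. T \<subseteq> e). \<Sum>T\<in>?Sat. if T \<subseteq> e then w e else 0)"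
  proof (rule sum_mono)
    fix e assume "e \<in> {e. e \<subseteq> V \<and> (\<exists>T\<in>?Sat. T \<subseteq> e)}"
    then obtain T where T: "T \<in> ?Sat" "T \<subseteq> e" by blast
    have "(if T \<subseteq> e then w e else 0) \<le> (\<Sum>T\<in>?Sat. if T \<subseteq> e then w e else 0)"
      using T finSat w0 by (intro member_le_sum) auto
    then show "w e \<le> (\<Sum>T\<in>?Sat. if T \<subseteq> e then w e else 0)" using T by simp
  qed
  also have "\<dots> \<le> (\<Sum>e\<in>Pow V. \<Sum>T\<in>?Sat. if T \<subseteq> e then w e else 0)"
    using fin w0 by (intro sum_mono2 sum_nonneg) auto
  also have "\<dots> = (\<Sum>T\<in>?Sat. wdeg V w T)"
    unfolding wdeg_eq_sum_Pow[OF fin] by (rule sum.swap)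
  also have "\<dots> \<le> (\<Sum>T\<in>?Sat. wdeg V w' T / (M * \<tau>))"
  proof (rule sum_mono)
    fix T assume T: "T \<in> ?Sat"
    then have T': "T \<subseteq> V" "T \<noteq> {}" "M * \<tau> ^ card T < wdeg V w' T" by (auto simp: saturated_def)
    then have "card T \<noteq> 0" using fin finite_subset by fastforce
    then have "\<tau> ^ card T = \<tau> * \<tau> ^ (card T - 1)" by (cases "card T") auto
    then have "\<tau> ^ (card T - 1) \<le> wdeg V w' T / (M * \<tau>)"
      using T' assms(3,4) by (simp add: field_simps)
    moreover have "wdeg V w T \<le> \<tau> ^ (card T - 1)" using bal T' by (simp add: balanced_def)
    ultimately show "wdeg V w T \<le> wdeg V w' T / (M * \<tau>)" by linarith
  qed
  also have "\<dots> \<le> (\<Sum>T\<in>Pow V. wdeg V w' T / (M * \<tau>))"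
    using fin assms(3,4) tr
    by (intro sum_mono2) (auto simp: saturated_def trace_of_def wdeg_nonneg)
  also have "\<dots> = 2 ^ h * wdeg V w' {} / (M * \<tau>)"
    unfolding sum_divide_distrib[symmetric]
    by (subst sum_wdeg_uniform[OF fin]) (use tr in \<open>auto simp: trace_of_def\<close>)
  also have "\<dots> \<le> 2 ^ h * (\<tau> * real (card V)) / (M * \<tau>)"
    using tr S assms(3,4) by (intro divide_right_mono mult_left_mono) (auto simp: trace_of_def)
  also have "\<dots> = 2 ^ h / M * real (card V)" using assms(3) by simp
  finally show ?thesis .
qed

text \<open>By the choice of \<open>M\<close>, edges over saturated sets carry weight at most
  \<open>c / 4 * card V\<close>. Vertices of residual degree below \<open>\<beta>\<close> account
  for at most another \<open>c / 4 * card V\<close>. The remaining \<open>c / 2 * card V\<close>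
  must come from the other vertices, each of which contributes at most \<open>1\<close>.\<close>

lemma many_vertices_of_large_residual:
  assumes fin: "finite V" and bal: "balanced V (Suc h) c \<tau> w" and "0 < \<tau>" "0 < c"
    and M: "M = 2 ^ h * 4 / c" and \<beta>: "\<beta> = c / 4"
    and tr: "trace_of V h w \<tau> M \<beta> S w'" and S: "real (card S) \<le> \<tau> * real (card V)"
  shows "c / 2 * real (card V) \<le> real (card {v\<in>V. \<beta> \<le> wdeg V (link V w \<tau> M w' v) {}})"
proof -
  let ?ok = "\<lambda>f. \<forall>T\<in>saturated V \<tau> M w'. \<not> T \<subseteq> f"
  let ?res = "\<lambda>v. wdeg V (link V w \<tau> M w' v) {}"
  let ?B = "{v\<in>V. \<beta> \<le> ?res v}"
  have w0: "0 \<le> w e" for e using bal by (simp add: balanced_def)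
  have M0: "0 < M" using M assms(4) by simp
  have res1: "?res v \<le> 1" if "v \<in> V" for v
    using wdeg_link_le_power[OF fin bal that, of "{}" M w'] assms(3) by simp
  \<comment> \<open>The link forbids saturated sets only inside \<open>e - {v}\<close>, so the edges
    without any saturated subset give a lower bound.\<close>
  have res_ge: "(\<Sum>e | e \<subseteq> V \<and> v \<in> e \<and> ?ok e. w e) \<le> ?res v" if "v \<in> V" for v
  proof -
    let ?E = "{e. e \<subseteq> V \<and> v \<in> e \<and> ?ok e}"
    have "(\<Sum>e\<in>?E. w e) = (\<Sum>e\<in>?E. link V w \<tau> M w' v (e - {v}))"
      by (rule sum.cong) (auto simp: link_def insert_absorb)
    also have "\<dots> = (\<Sum>f\<in>(\<lambda>e. e - {v}) ` ?E. link V w \<tau> M w' v f)"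
      by (subst sum.reindex) (auto simp: inj_on_def)
    also have "\<dots> \<le> ?res v"
      unfolding wdeg_def using fin link_nonneg[of w] w0 by (intro sum_mono2) auto
    finally show ?thesis .
  qed
  have "c * real (card V) \<le> wdeg V w {}" using bal by (simp add: balanced_def)
  also have "\<dots> = (\<Sum>e | e \<subseteq> V \<and> ?ok e. w e) + (\<Sum>e | e \<subseteq> V \<and> \<not> ?ok e. w e)"
    unfolding wdeg_def using fin
    by (subst sum.union_disjoint[symmetric]) (auto intro: sum.cong)
  also have "(\<Sum>e | e \<subseteq> V \<and> \<not> ?ok e. w e) \<le> 2 ^ h / M * real (card V)"
    using weight_of_saturated_edges[OF fin bal assms(3) M0 tr S] by simp
  also have "2 ^ h / M = c / 4" using M assms(4) by simp
  \<comment> \<open>An edge of nonzero weight has \<open>Suc h\<close> vertices and is therefore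
    counted at least once.\<close>
  also have "(\<Sum>e | e \<subseteq> V \<and> ?ok e. w e) \<le> (\<Sum>e | e \<subseteq> V \<and> ?ok e. \<Sum>v\<in>V. if v \<in> e then w e else 0)"
  proof (rule sum_mono)
    fix e assume e: "e \<in> {e. e \<subseteq> V \<and> ?ok e}"
    then have "(\<Sum>v\<in>V. if v \<in> e then w e else 0) = real (card e) * w e"
      using fin by (simp add: sum.If_cases Int_absorb1)
    moreover have "w e \<noteq> 0 \<Longrightarrow> card e = Suc h" using balancedD(2)[OF bal] e by simp
    ultimately show "w e \<le> (\<Sum>v\<in>V. if v \<in> e then w e else 0)"
      using w0[of e] by (cases "w e = 0") (auto simp: algebra_simps)
  qed
  also have "\<dots> = (\<Sum>v\<in>V. \<Sum>e | e \<subseteq> V \<and> ?ok e. if v \<in> e then w e else 0)"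
    by (rule sum.swap)
  also have "\<dots> = (\<Sum>v\<in>V. \<Sum>e | e \<subseteq> V \<and> v \<in> e \<and> ?ok e. w e)"
    by (rule sum.cong[OF refl]) (use fin in \<open>simp add: sum.inter_filter[symmetric] conj_ac\<close>)
  also have "\<dots> \<le> (\<Sum>v\<in>V. if \<beta> \<le> ?res v then 1 else \<beta>)"
    by (rule sum_mono) (use res_ge res1 in force)
  also have "\<dots> \<le> (\<Sum>v\<in>V. (if \<beta> \<le> ?res v then 1 else 0) + \<beta>)"
    using \<beta> assms(4) by (intro sum_mono) auto
  also have "\<dots> = real (card ?B) + \<beta> * real (card V)"
    using fin by (simp add: sum.distrib sum.If_cases Int_def)
  finally show ?thesis by (simp add: \<beta> algebra_simps)
qed

text \<open>The fingerprint of an independent set \<open>I\<close> is a maximal \<open>S \<subseteq> I\<close> with at most \<open>\<tau>|V|\<close> elements that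
  has a trace. The container may only depend on \<open>S\<close>, so one trace is fixed for each \<open>S\<close>: if \<open>S\<close> is
  small, maximality keeps every vertex of large residual degree with respect to this trace out of
  \<open>I - S\<close>, whatever trace was used to build \<open>S\<close>; if \<open>S\<close> has full size, the trace is a balanced
  weight of lower uniformity for which \<open>I\<close> is still independent.\<close>

lemma container_step:
  fixes V :: "'e set"
  assumes fin: "finite V" and bal: "balanced V (Suc h) c \<tau> w" and c: "0 < c"
    and \<tau>: "0 < \<tau>" "\<tau> \<le> c / 4" "1 \<le> \<tau> * real (card V)"
    and M: "M = 2 ^ h * 4 / c"
    and IH: "\<And>w'. balanced V h (c / (8 * (M + 1))) \<tau> w' \<Longrightarrow>
      \<exists>\<C>. finite \<C> \<and> card \<C> \<le> K \<and> container_family V w' \<delta> \<C>"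
    and \<delta>: "\<delta> \<le> c / 4" and K: "1 \<le> K"
  shows "\<exists>\<C>. finite \<C> \<and> card \<C> \<le> card (small_sets V (\<tau> * real (card V))) * K \<and>
           container_family V w \<delta> \<C>"
proof -
  define N where "N = real (card V)"
  define \<beta> where "\<beta> = c / 4"
  define L where "L = nat \<lfloor>\<tau> * N\<rfloor>"
  let ?tr = "trace_of V h w \<tau> M \<beta>"
  have L: "real L \<le> \<tau> * N" "\<tau> * N / 2 \<le> real L"
  proof -
    have L': "real L = of_int \<lfloor>\<tau> * N\<rfloor>" using \<tau> unfolding L_def N_def by simp
    show "real L \<le> \<tau> * N" unfolding L' by simp
    \<comment> \<open>As \<open>\<tau> * N\<close> is at least \<open>1\<close>, rounding down loses
      at most half of it.\<close>
    show "\<tau> * N / 2 \<le> real L" 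
    proof -
      have "1 \<le> \<lfloor>\<tau> * N\<rfloor>" using \<tau>(3) by (simp add: N_def)
      then have "1 \<le> real_of_int \<lfloor>\<tau> * N\<rfloor>" by linarith
      then show ?thesis using real_of_int_floor_add_one_gt[of "\<tau> * N"] unfolding L' by linarith
    qed
  qed
  have M0: "0 < M" using M c by simp
  define \<S> where "\<S> = {S. S \<subseteq> V \<and> card S \<le> L \<and> (\<exists>w'. ?tr S w')}"
  define indep where "indep = (\<lambda>I. I \<subseteq> V \<and> (\<forall>e\<subseteq>I. w e = 0))"
  have \<S>_sub: "\<S> \<subseteq> small_sets V (\<tau> * N)"
    using L by (auto simp: \<S>_def small_sets_def)
  have fin_small: "finite (small_sets V (\<tau> * N))" using fin by (simp add: small_sets_def)
  then have fin\<S>: "finite \<S>" using \<S>_sub finite_subset by blast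
  \<comment> \<open>The containers depend on \<open>S\<close> alone. The premises of the last clause
    describe the independent sets \<open>I\<close> with fingerprint \<open>S\<close>: if
    \<open>S\<close> is short, no vertex of \<open>I\<close> extends it.\<close>
  have "\<exists>\<C>. finite \<C> \<and> card \<C> \<le> K \<and>
      (\<forall>C\<in>\<C>. C \<subseteq> V \<and> real (card C) \<le> (1 - \<delta>) * N) \<and>
      (\<forall>I. indep I \<longrightarrow> S \<subseteq> I \<longrightarrow> (card S < L \<longrightarrow> (\<forall>v\<in>I - S. insert v S \<notin> \<S>)) \<longrightarrow>
        (\<exists>C\<in>\<C>. I \<subseteq> C))" if S: "S \<in> \<S>" for S
  proof -
    obtain w' where tr: "?tr S w'" using S by (auto simp: \<S>_def)
    have SV: "S \<subseteq> V" "card S \<le> L" using S by (auto simp: \<S>_def)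
    have finS: "finite S" using SV fin finite_subset by blast
    show ?thesis
    proof (cases "card S < L")
      case True
      define B where "B = {v\<in>V. \<beta> \<le> wdeg V (link V w \<tau> M w' v) {}}"
      have SN: "real (card S) \<le> \<tau> * N" using L SV by linarith
      have B: "c / 2 * N \<le> real (card B)"
        using many_vertices_of_large_residual[OF fin bal \<tau>(1) c M \<beta>_def tr] SN
        by (simp add: B_def N_def)
      have "real (card (S \<union> (V - B))) \<le> real (card S) + real (card (V - B))"
        using card_Un_le[of S "V - B"] by linarith
      also have "real (card (V - B)) = N - real (card B)"
        unfolding N_def using fin B_def
        by (subst card_Diff_subset) (auto intro: card_mono of_nat_diff)
      \<comment> \<open>The set \<open>S\<close> costs at most \<open>c / 4 * N\<close> while
        \<open>B\<close> saves \<open>c / 2 * N\<close>; the net saving is at least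
        \<open>\<delta> * N\<close>.\<close>
      also have "real (card S) + (N - real (card B)) \<le> c / 4 * N + (N - c / 2 * N)"
      proof -
        have "\<tau> * N \<le> c / 4 * N" using \<tau>(2) by (intro mult_right_mono) (auto simp: N_def)
        then show ?thesis using SN B by linarith
      qed
      also have "\<dots> \<le> (1 - \<delta>) * N"
      proof -
        have "\<delta> * N \<le> c / 4 * N" using \<delta> by (intro mult_right_mono) (auto simp: N_def)
        then show ?thesis by (simp add: algebra_simps)
      qed
      finally have small: "real (card (S \<union> (V - B))) \<le> (1 - \<delta>) * N" .
      have cover: "I \<subseteq> S \<union> (V - B)"
        if I: "indep I" "\<forall>v\<in>I - S. insert v S \<notin> \<S>" for I
      proof
        fix v assume v: "v \<in> I"
        show "v \<in> S \<union> (V - B)"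
        proof (rule ccontr)
          assume neg: "v \<notin> S \<union> (V - B)"
          then have v': "v \<in> V" "v \<notin> S" "\<beta> \<le> wdeg V (link V w \<tau> M w' v) {}"
            using v I(1) by (auto simp: indep_def B_def)
          have "\<exists>w''. ?tr (insert v S) w''"
            using trace_of_insert[OF fin bal _ _ tr v'] \<tau> M0 by auto
          then have "insert v S \<in> \<S>" using SV v' True finS by (auto simp: \<S>_def)
          then show False using I(2) v v' by blast
        qed
      qed
      show ?thesis
        by (rule exI[of _ "{S \<union> (V - B)}"]) (use small cover K SV True in auto)
    next
      case False
      then have cS: "card S = L" using SV by simp
      \<comment> \<open>Dividing by \<open>(M + 1) * \<tau>\<close> turns the bound
        \<open>(M + 1) * \<tau> ^ card T\<close> into \<open>\<tau> ^ (card T - 1)\<close>. The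
        total weight of \<open>w'\<close> is at least \<open>\<beta> * L\<close>, hence at least
        \<open>c / 4 * (\<tau> * N / 2)\<close>; this is where \<open>c / (8 * (M + 1))\<close>
        comes from.\<close>
      define w2 where "w2 = (\<lambda>f. 1 / ((M + 1) * \<tau>) * w' f)"
      have wdeg_w2: "wdeg V w2 T = wdeg V w' T / ((M + 1) * \<tau>)" for T
        unfolding w2_def wdeg_scale by simp
      have deg2: "wdeg V w2 T \<le> \<tau> ^ (card T - 1)" if T: "T \<subseteq> V" "T \<noteq> {}" for T
      proof -
        have "card T \<noteq> 0" using T fin finite_subset by fastforce
        then have "\<tau> ^ card T = \<tau> * \<tau> ^ (card T - 1)" by (cases "card T") auto
        moreover have "wdeg V w' T \<le> (M + 1) * \<tau> ^ card T" using trace_ofD(5)[OF tr T] .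
        moreover have "0 < (M + 1) * \<tau>" using \<tau> M0 by simp
        ultimately show ?thesis unfolding wdeg_w2 by (simp add: pos_divide_le_eq mult_ac)
      qed
      have "c / 4 * (\<tau> * N / 2) \<le> c / 4 * real L" using L c by (intro mult_left_mono) auto
      also have "\<dots> \<le> wdeg V w' {}" using tr cS by (simp add: trace_of_def \<beta>_def)
      finally have "c / 4 * (\<tau> * N / 2) / ((M + 1) * \<tau>) \<le> wdeg V w2 {}"
        unfolding wdeg_w2 using \<tau> M0 by (intro divide_right_mono) auto
      moreover have "c / 4 * (\<tau> * N / 2) / ((M + 1) * \<tau>) = c / (8 * (M + 1)) * N"
        using \<tau> M0 by simp
      ultimately have tot2: "c / (8 * (M + 1)) * N \<le> wdeg V w2 {}" by simp
      have "balanced V h (c / (8 * (M + 1))) \<tau> w2"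
        unfolding balanced_def
      proof (intro conjI)
        show "\<forall>e. 0 \<le> w2 e" using tr \<tau> M0 by (simp add: w2_def trace_of_def)
        show "\<forall>e\<subseteq>V. w2 e \<noteq> 0 \<longrightarrow> card e = h" using tr by (auto simp: w2_def trace_of_def)
      qed (use deg2 tot2 N_def in auto)
      then obtain \<C> where \<C>: "finite \<C>" "card \<C> \<le> K" "container_family V w2 \<delta> \<C>"
        using IH by blast
      have "\<exists>C\<in>\<C>. I \<subseteq> C" if I: "indep I" "S \<subseteq> I" for I
      proof -
        have "w2 f = 0" if f: "f \<subseteq> I" for f
        proof (rule ccontr)
          assume "w2 f \<noteq> 0"
          then have "w' f \<noteq> 0" by (simp add: w2_def)
          moreover have "f \<subseteq> V" using f I by (auto simp: indep_def)
          ultimately obtain v where "v \<in> S" "w (insert v f) \<noteq> 0"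
            using trace_ofD(4)[OF tr] by blast
          then show False using I f by (auto simp: indep_def)
        qed
        then show ?thesis using \<C>(3) I unfolding container_family_def indep_def by blast
      qed
      then show ?thesis
        using \<C> by (intro exI[of _ \<C>]) (auto simp: container_family_def N_def)
    qed
  qed
  then obtain F where F: "\<And>S. S \<in> \<S> \<Longrightarrow> finite (F S) \<and> card (F S) \<le> K \<and>
      (\<forall>C\<in>F S. C \<subseteq> V \<and> real (card C) \<le> (1 - \<delta>) * N) \<and>
      (\<forall>I. indep I \<longrightarrow> S \<subseteq> I \<longrightarrow> (card S < L \<longrightarrow> (\<forall>v\<in>I - S. insert v S \<notin> \<S>)) \<longrightarrow>
        (\<exists>C\<in>F S. I \<subseteq> C))"
    by metis
  \<comment> \<open>The zero weight is a trace of the empty set, so a largest fingerprint inside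
    \<open>I\<close> always exists.\<close>
  have empty: "{} \<in> \<S>"
    unfolding \<S>_def trace_of_def
    by (auto intro!: exI[of _ "\<lambda>_. 0"] simp: wdeg_def M0 \<tau> less_imp_le)
  have cover: "\<exists>C\<in>(\<Union>S\<in>\<S>. F S). I \<subseteq> C" if I: "indep I" for I
  proof -
    have fin_I: "finite {S\<in>\<S>. S \<subseteq> I}" using fin\<S> by simp
    moreover have "{S\<in>\<S>. S \<subseteq> I} \<noteq> {}" using empty by blast
    ultimately have "Max (card ` {S\<in>\<S>. S \<subseteq> I}) \<in> card ` {S\<in>\<S>. S \<subseteq> I}"
      by (intro Max_in) auto
    then obtain S where S: "S \<in> {S\<in>\<S>. S \<subseteq> I}"
      and "card S = Max (card ` {S\<in>\<S>. S \<subseteq> I})" by auto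
    then have max: "\<forall>S'\<in>{S\<in>\<S>. S \<subseteq> I}. card S' \<le> card S"
      using fin_I by simp
    have finS: "finite S" using S fin finite_subset unfolding \<S>_def by blast
    have "insert v S \<notin> \<S>" if "v \<in> I - S" for v
    proof
      assume "insert v S \<in> \<S>"
      then have "card (insert v S) \<le> card S" using max S that by blast
      then show False using finS that by auto
    qed
    then show ?thesis using F[of S] S I by blast
  qed
  have "card (\<Union>S\<in>\<S>. F S) \<le> (\<Sum>S\<in>\<S>. card (F S))" by (rule card_UN_le[OF fin\<S>])
  also have "\<dots> \<le> card \<S> * K" using sum_bounded_above[of \<S> "\<lambda>S. card (F S)" K] F by simp
  also have "\<dots> \<le> card (small_sets V (\<tau> * N)) * K"
    using card_mono[OF fin_small \<S>_sub] by simp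
  finally have cardU: "card (\<Union>S\<in>\<S>. F S) \<le> card (small_sets V (\<tau> * N)) * K" .
  have "container_family V w \<delta> (\<Union>S\<in>\<S>. F S)"
    unfolding container_family_def
  proof (intro conjI ballI allI impI)
    fix C assume "C \<in> (\<Union>S\<in>\<S>. F S)"
    then obtain S where "S \<in> \<S>" "C \<in> F S" by blast
    then show "C \<subseteq> V" "real (card C) \<le> (1 - \<delta>) * real (card V)"
      using F[of S] by (auto simp: N_def)
  next
    fix I assume "I \<subseteq> V" "\<forall>e\<subseteq>I. w e = 0"
    then show "\<exists>C\<in>(\<Union>S\<in>\<S>. F S). I \<subseteq> C" using cover by (simp add: indep_def)
  qed
  moreover have "finite (\<Union>S\<in>\<S>. F S)" using fin\<S> F by blast
  ultimately show ?thesis using cardU unfolding N_def by blast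
qed

text \<open>Induction on the uniformity, with the same \<tau> at every level: a step lowers
  \<open>h\<close> by one, replaces \<open>c\<close> by a smaller constant, and multiplies the
  number of containers by the number of fingerprints. The constants \<delta> and
  \<open>\<tau>\<^sub>0\<close> are fixed before \<open>V\<close>, \<tau> and
  \<open>w\<close>.\<close>

theorem containers:
  assumes "1 \<le> h" "0 < c"
  shows "\<exists>\<delta>>0. \<exists>\<tau>\<^sub>0>0. \<forall>(V :: 'e set) \<tau> w.
    finite V \<longrightarrow> 0 < \<tau> \<longrightarrow> \<tau> \<le> \<tau>\<^sub>0 \<longrightarrow> 1 \<le> \<tau> * real (card V) \<longrightarrow> balanced V h c \<tau> w \<longrightarrow>
    (\<exists>\<C>. finite \<C> \<and> card \<C> \<le> card (small_sets V (\<tau> * real (card V))) ^ (h - 1) \<and>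
      container_family V w \<delta> \<C>)"
  using assms
proof (induction h arbitrary: c rule: dec_induct)
  case base
  show ?case
  proof (rule exI[of _ c], rule conjI[OF base], rule exI[of _ 1], intro conjI allI impI)
    fix V :: "'e set" and \<tau> w
    assume V: "finite V" "balanced V 1 c \<tau> w"
    show "\<exists>\<C>. finite \<C> \<and> card \<C> \<le> card (small_sets V (\<tau> * real (card V))) ^ (1 - 1) \<and>
        container_family V w c \<C>"
      using container_uniformity_one[OF V] by (intro exI[of _ "{{v\<in>V. w {v} = 0}}"]) simp
  qed simp
next
  case (step h)
  define M where "M = 2 ^ h * 4 / c"
  have "0 < c / (8 * (M + 1))" using step by (simp add: M_def add_pos_pos)
  from step.IH[OF this] obtain \<delta> \<tau>\<^sub>0 where d: "0 < \<delta>" "0 < \<tau>\<^sub>0" and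
    *: "\<And>(V :: 'e set) \<tau> w.
      finite V \<Longrightarrow> 0 < \<tau> \<Longrightarrow> \<tau> \<le> \<tau>\<^sub>0 \<Longrightarrow> 1 \<le> \<tau> * real (card V) \<Longrightarrow>
      balanced V h (c / (8 * (M + 1))) \<tau> w \<Longrightarrow>
      \<exists>\<C>. finite \<C> \<and> card \<C> \<le> card (small_sets V (\<tau> * real (card V))) ^ (h - 1) \<and>
        container_family V w \<delta> \<C>"
    by blast
  have mono: "container_family V w (min \<delta> (c / 4)) \<C>" if "container_family V w \<delta> \<C>"
    for V w and \<C> :: "'e set set"
  proof -
    have "(1 - \<delta>) * real (card V) \<le> (1 - min \<delta> (c / 4)) * real (card V)"
      by (intro mult_right_mono) auto
    then show ?thesis using that unfolding container_family_def by force
  qed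
  show ?case
  proof (rule exI[of _ "min \<delta> (c / 4)"], rule conjI, goal_cases)
    case 2
    show ?case
    proof (rule exI[of _ "min \<tau>\<^sub>0 (c / 4)"], intro conjI allI impI)
      fix V :: "'e set" and \<tau> w
      assume V: "finite V" "0 < \<tau>" "\<tau> \<le> min \<tau>\<^sub>0 (c / 4)" "1 \<le> \<tau> * real (card V)"
        "balanced V (Suc h) c \<tau> w"
      let ?s = "small_sets V (\<tau> * real (card V))"
      \<comment> \<open>A short fingerprint has one container, so the bound passed to
        \<open>container_step\<close> must be at least \<open>1\<close>.\<close>
      have "{} \<in> ?s" using V by (simp add: small_sets_def)
      moreover have "finite ?s" using V by (simp add: small_sets_def)
      ultimately have one: "1 \<le> card ?s ^ (h - 1)"
        by (metis Suc_leI card_gt_0_iff emptyE One_nat_def one_le_power)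
      have "\<exists>\<C>. finite \<C> \<and> card \<C> \<le> card ?s * card ?s ^ (h - 1) \<and>
          container_family V w (min \<delta> (c / 4)) \<C>"
      proof (rule container_step[OF V(1,5) step.prems V(2) _ V(4) M_def])
        fix w' assume "balanced V h (c / (8 * (M + 1))) \<tau> w'"
        then obtain \<C> where "finite \<C>" "card \<C> \<le> card ?s ^ (h - 1)" "container_family V w' \<delta> \<C>"
          using *[OF V(1,2) _ V(4)] V(3) by auto
        then show "\<exists>\<C>. finite \<C> \<and> card \<C> \<le> card ?s ^ (h - 1) \<and>
            container_family V w' (min \<delta> (c / 4)) \<C>"
          using mono by blast
      qed (use V one in auto)
      moreover have "card ?s * card ?s ^ (h - 1) = card ?s ^ (Suc h - 1)"
        using step by (cases h) auto
      ultimately show "\<exists>\<C>. finite \<C> \<and> card \<C> \<le> card ?s ^ (Suc h - 1) \<and>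
          container_family V w (min \<delta> (c / 4)) \<C>" by simp
    qed (use d step in auto)
  qed (use d step in auto)
qed

text \<open>Give each \<open>S\<close> the weight \<open>\<tau> ^ card S\<close>. As
  \<open>\<tau> \<le> 1\<close>, a small set weighs at least
  \<open>\<tau> powr (\<tau> * card V)\<close>, while all subsets together weigh
  \<open>(1 + \<tau>) ^ card V\<close>.\<close>

lemma card_small_sets:
  assumes "finite V" "0 < \<tau>" "\<tau> \<le> 1"
  shows "real (card (small_sets V (\<tau> * real (card V))))
    \<le> exp (\<tau> * real (card V) * (1 + ln (1 / \<tau>)))"
proof -
  let ?N = "real (card V)" and ?s = "small_sets V (\<tau> * real (card V))"
  have fins: "finite ?s" using assms by (simp add: small_sets_def)
  have "real (card ?s) * \<tau> powr (\<tau> * ?N) = (\<Sum>S\<in>?s. \<tau> powr (\<tau> * ?N))" by simp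
  also have "\<dots> \<le> (\<Sum>S\<in>?s. \<tau> ^ card S)"
    using assms by (intro sum_mono) (auto simp: small_sets_def powr_realpow[symmetric] intro: powr_mono')
  also have "\<dots> \<le> (\<Sum>S\<in>Pow V. \<tau> ^ card S)"
    using assms by (intro sum_mono2) (auto simp: small_sets_def)
  also have "\<dots> = (1 + \<tau>) ^ card V"
    using prod_add[of V "\<lambda>_. \<tau>" "\<lambda>_. 1"] assms(1) by (simp add: add.commute)
  also have "\<dots> \<le> exp \<tau> ^ card V" using assms by (intro power_mono exp_ge_add_one_self) auto
  also have "\<dots> = exp (\<tau> * ?N)" by (simp add: exp_of_nat_mult[symmetric] mult.commute)
  finally have "real (card ?s) \<le> exp (\<tau> * ?N) / \<tau> powr (\<tau> * ?N)"
    using assms by (simp add: field_simps)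
  also have "\<dots> = exp (\<tau> * ?N * (1 + ln (1 / \<tau>)))"
    using assms by (simp add: powr_def exp_diff[symmetric] ln_div algebra_simps)
  finally show ?thesis .
qed

section \<open>Balanced supersaturation\<close>

text \<open>Only the edge set of a copy is kept, because copies become the edges of a weighted
  hypergraph whose vertices are the edges of \<open>G\<close>. Isolated vertices of \<open>H\<close>
  still need room in \<open>X\<close>.\<close>

definition is_copy :: "'b set \<Rightarrow> 'a hypergraph \<Rightarrow> 'b set set \<Rightarrow> bool" where
  "is_copy X H D \<longleftrightarrow>
     (\<exists>f. inj_on f (verts H) \<and> f ` verts H \<subseteq> X \<and> D = (`) f ` edges H)"

lemma contains_copy_iff: "contains_copy (X, E) H \<longleftrightarrow> (\<exists>D\<subseteq>E. is_copy X H D)"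
  unfolding contains_copy_def is_copy_def by (auto; blast)

lemma is_copy_mono: "is_copy W H D \<Longrightarrow> W \<subseteq> X \<Longrightarrow> is_copy X H D"
  unfolding is_copy_def by blast

lemma finite_edges:
  assumes "uniform_hypergraph r H"
  shows "finite (edges H)"
proof (rule finite_subset)
  show "edges H \<subseteq> Pow (verts H)" using assms by (auto simp: uniform_hypergraph_def)
qed (use assms in \<open>simp add: uniform_hypergraph_def\<close>)

lemma inj_on_image_edges:
  assumes "uniform_hypergraph r H" "inj_on f (verts H)"
  shows "inj_on ((`) f) (edges H)"
  using inj_on_image_Pow[OF assms(2)] assms(1)
  by (auto simp: uniform_hypergraph_def intro: inj_on_subset)

lemma card_copy:
  assumes "uniform_hypergraph r H" "is_copy X H D"
  shows "card D = card (edges H)"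
  using assms(2) card_image[OF inj_on_image_edges[OF assms(1)]] unfolding is_copy_def by blast

section \<open>Density and the span of edge sets\<close>

text \<open>Two different \<open>r\<close>-sets span more than \<open>r\<close> vertices, so
  \<open>(\<Union>E, E)\<close> is one of the subhypergraphs in the maximum that defines the
  density.\<close>

lemma r_density_ge:
  assumes H: "uniform_hypergraph r H" and E: "E \<subseteq> edges H" "2 \<le> card E"
  shows "r < card (\<Union>E)"
    and "real (card E) - 1 \<le> r_density r H * (real (card (\<Union>E)) - real r)"
proof -
  have fV: "finite (verts H)" using H by (simp add: uniform_hypergraph_def)
  have EV: "\<Union>E \<subseteq> verts H" using H E by (auto simp: uniform_hypergraph_def)
  have fU: "finite (\<Union>E)" using EV fV finite_subset by blast
  obtain e1 e2 where e: "e1 \<in> E" "e2 \<in> E" "e1 \<noteq> e2"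
    using E(2) by (metis One_nat_def Suc_1 card_le_Suc0_iff_eq card.infinite not_less_eq_eq zero_le)
  have c: "card e1 = r" "card e2 = r" using e E H by (auto simp: uniform_hypergraph_def)
  have "e1 \<subset> \<Union>E"
  proof (rule ccontr)
    assume "\<not> e1 \<subset> \<Union>E"
    then have "\<Union>E = e1" using e by blast
    then have "e2 \<subseteq> e1" "finite e1" using e fU by auto
    then show False using card_subset_eq c e by metis
  qed
  then show gt: "r < card (\<Union>E)" using psubset_card_mono[OF fU] c by blast
  let ?R = "{(real (card (edges F)) - 1) / (real (card (verts F)) - real r) | F.
                  subhypergraph F H \<and> card (verts F) > r}"
  have "?R \<subseteq> (\<lambda>F. (real (card (edges F)) - 1) / (real (card (verts F)) - real r)) `
      {F. subhypergraph F H}"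
    by blast
  then have "finite ?R" using finite_subhypergraphs[OF H] finite_surj by blast
  moreover have "(real (card E) - 1) / (real (card (\<Union>E)) - real r) \<in> ?R"
    using E EV gt by (intro CollectI exI[of _ "(\<Union>E, E)"]) (auto simp: subhypergraph_def)
  moreover have "\<not> card (verts H) \<le> r" using gt card_mono[OF fV EV] by simp
  ultimately have "(real (card E) - 1) / (real (card (\<Union>E)) - real r) \<le> r_density r H"
    by (simp add: r_density_def)
  then show "real (card E) - 1 \<le> r_density r H * (real (card (\<Union>E)) - real r)"
    using gt by (simp add: pos_divide_le_eq)
qed

text \<open>Two edges span at most \<open>2 * r\<close> vertices, so a pair of edges already has
  density at least \<open>1 / r\<close>. The second bound makes the exponent
  \<open>r - 1 / r_density r H\<close> nonnegative.\<close>

lemma r_density_bounds: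
  assumes H: "uniform_hypergraph r H" and "2 \<le> card (edges H)"
  shows "0 < r_density r H" "1 \<le> real r * r_density r H"
proof -
  obtain E where E: "E \<subseteq> edges H" "card E = 2"
    using obtain_subset_with_card_n[OF assms(2)] by metis
  then obtain e1 e2 where e: "E = {e1, e2}" by (auto simp: card_2_iff)
  have "card e1 = r" "card e2 = r" using E e H by (auto simp: uniform_hypergraph_def)
  then have "card (\<Union>E) \<le> 2 * r" using card_Un_le[of e1 e2] e by simp
  moreover note r_density_ge[OF H E(1)]
  ultimately have *: "1 \<le> r_density r H * (real (card (\<Union>E)) - real r)"
    "0 < real (card (\<Union>E)) - real r" "real (card (\<Union>E)) - real r \<le> real r"
    using E(2) by auto
  then show pos: "0 < r_density r H"
    by (metis less_le_trans zero_less_mult_pos2 zero_less_one)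
  have "r_density r H * (real (card (\<Union>E)) - real r) \<le> r_density r H * real r"
    using * pos by (intro mult_left_mono) auto
  then show "1 \<le> real r * r_density r H" using * by (simp add: mult.commute)
qed

text \<open>An embedding is injective, so \<open>T\<close> pulls back to an edge set of
  \<open>H\<close> of the same size and with a span of the same size.\<close>

lemma span_of_copy_subset:
  assumes H: "uniform_hypergraph r H" and D: "is_copy X H D" and T: "T \<subseteq> D" "2 \<le> card T"
  shows "real (card T) - 1 \<le> r_density r H * (real (card (\<Union>T)) - real r)"
proof -
  obtain f where f: "inj_on f (verts H)" "D = (`) f ` edges H" using D by (auto simp: is_copy_def)
  then obtain E where E: "E \<subseteq> edges H" "T = (`) f ` E" using T(1) by (metis subset_imageE)
  have "card T = card E"
    unfolding E(2) using inj_on_image_edges[OF H f(1)] E(1) inj_on_subset by (intro card_image) blast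
  moreover have "\<Union>T = f ` \<Union>E" using E(2) by auto
  moreover have "card (f ` \<Union>E) = card (\<Union>E)"
  proof (rule card_image)
    have "\<Union>E \<subseteq> verts H" using E(1) H by (auto simp: uniform_hypergraph_def)
    then show "inj_on f (\<Union>E)" using f(1) inj_on_subset by blast
  qed
  ultimately show ?thesis using r_density_ge(2)[OF H E(1)] T(2) by simp
qed

section \<open>Edge-disjoint copies inside a vertex set\<close>

lemma card_le_ex_num:
  fixes W :: "nat set"
  assumes "finite W" "\<And>e. e \<in> E \<Longrightarrow> e \<subseteq> W \<and> card e = r" "\<not> contains_copy (W, E) H"
  shows "card E \<le> ex_num r (card W) H"
  unfolding ex_num_def
  using assms
  by (intro cSup_upper bdd_above_ex_num CollectI exI[of _ "(W, E)"])
    (auto simp: uniform_hypergraph_def)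

text \<open>In a family \<open>P\<close> of maximum size, a copy among the uncovered edges could be
  added. So the uncovered edges are \<open>H\<close>-free and bounded by \<open>ex_num\<close>, and
  each member of \<open>P\<close> covers \<open>card (edges H)\<close> edges.\<close>

lemma disjoint_copies:
  fixes W :: "nat set"
  assumes H: "uniform_hypergraph r H" "edges H \<noteq> {}"
    and W: "finite W" and E: "\<And>e. e \<in> E \<Longrightarrow> e \<subseteq> W \<and> card e = r"
  shows "\<exists>P. (\<forall>D\<in>P. D \<subseteq> E \<and> is_copy W H D) \<and> pairwise disjnt P \<and>
    card E \<le> card (edges H) * card P + ex_num r (card W) H"
proof -
  define \<P> where "\<P> = {P. (\<forall>D\<in>P. D \<subseteq> E \<and> is_copy W H D) \<and> pairwise disjnt P}"
  have finE: "finite E" using W E by (intro finite_subset[of E "Pow W"]) auto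
  have "\<P> \<subseteq> Pow (Pow E)" by (auto simp: \<P>_def)
  then have fin\<P>: "finite \<P>" using finE finite_subset by blast
  have "{} \<in> \<P>" by (simp add: \<P>_def)
  then have "Max (card ` \<P>) \<in> card ` \<P>" using fin\<P> by (intro Max_in) auto
  then obtain P where P: "P \<in> \<P>" "card P = Max (card ` \<P>)" by auto
  have max: "card P' \<le> card P" if "P' \<in> \<P>" for P' using that P(2) fin\<P> by simp
  have finP: "finite P" using P(1) finE by (intro finite_subset[of P "Pow E"]) (auto simp: \<P>_def)
  define R where "R = E - \<Union>P"
  have "\<not> contains_copy (W, R) H"
  proof
    assume "contains_copy (W, R) H"
    then obtain D where D: "D \<subseteq> R" "is_copy W H D" by (auto simp: contains_copy_iff)
    \<comment> \<open>A nonempty \<open>D\<close> outside the union of \<open>P\<close> is a new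
      member, so adding it strictly enlarges \<open>P\<close>.\<close>
    have "D \<noteq> {}" using D(2) H(2) by (auto simp: is_copy_def)
    then have "D \<notin> P" using D(1) by (auto simp: R_def)
    moreover have "insert D P \<in> \<P>"
      using P(1) D by (auto simp: \<P>_def R_def pairwise_insert disjnt_def)
    ultimately show False using max[of "insert D P"] finP by simp
  qed
  then have "card R \<le> ex_num r (card W) H"
    using E by (intro card_le_ex_num[OF W]) (auto simp: R_def)
  moreover have "card (\<Union>P) \<le> (\<Sum>D\<in>P. card D)" by (rule card_Union_le_sum_card)
  moreover have "(\<Sum>D\<in>P. card D) = card (edges H) * card P"
  proof -
    have "(\<Sum>D\<in>P. card D) = (\<Sum>D\<in>P. card (edges H))"
      using P(1) card_copy[OF H(1)] by (intro sum.cong refl) (auto simp: \<P>_def)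
    then show ?thesis by simp
  qed
  moreover have "card E \<le> card R + card (\<Union>P)"
  proof -
    have "E = R \<union> \<Union>P" using P(1) by (auto simp: R_def \<P>_def)
    then show ?thesis using card_Un_le[of R "\<Union>P"] by simp
  qed
  ultimately show ?thesis using P(1) by (intro exI[of _ P]) (auto simp: \<P>_def)
qed

section \<open>Counting the sets of size \<open>m\<close> that contain a given set\<close>

text \<open>Removing \<open>U\<close> is a bijection onto subsets of \<open>X - U\<close>. In the
  case \<open>m < card U\<close>, truncated subtraction would make the binomial coefficient
  \<open>1\<close> instead of \<open>0\<close>.\<close>

lemma card_supersets_of_size:
  assumes "finite X" "U \<subseteq> X"
  shows "card {W. W \<subseteq> X \<and> card W = m \<and> U \<subseteq> W} =
    (if card U \<le> m then (card X - card U) choose (m - card U) else 0)"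
proof (cases "card U \<le> m")
  case True
  have finU: "finite U" using assms finite_subset by blast
  have "bij_betw (\<lambda>W. W - U) {W. W \<subseteq> X \<and> card W = m \<and> U \<subseteq> W}
      {B. B \<subseteq> X - U \<and> card B = m - card U}"
  proof (rule bij_betw_byWitness[where f' = "\<lambda>B. B \<union> U"])
    show "(\<lambda>B. B \<union> U) ` {B. B \<subseteq> X - U \<and> card B = m - card U}
        \<subseteq> {W. W \<subseteq> X \<and> card W = m \<and> U \<subseteq> W}"
    proof (clarify, intro conjI)
      fix B assume B: "B \<subseteq> X - U" "card B = m - card U"
      then have "finite B" "B \<inter> U = {}" using assms finite_subset[of B X] by auto
      then show "card (B \<union> U) = m" using finU B True by (simp add: card_Un_disjoint)
    qed (use assms in auto)
  qed (use finU in \<open>auto simp: card_Diff_subset\<close>)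
  then have "card {W. W \<subseteq> X \<and> card W = m \<and> U \<subseteq> W} = card {B. B \<subseteq> X - U \<and> card B = m - card U}"
    by (rule bij_betw_same_card)
  then show ?thesis using True assms finU by (simp add: n_subsets card_Diff_subset)
next
  case False
  then have "{W. W \<subseteq> X \<and> card W = m \<and> U \<subseteq> W} = {}"
    using card_mono[OF finite_subset[OF _ assms(1)]] by blast
  then show ?thesis using False by (metis card.empty)
qed

lemma binomial_diff_Suc:
  assumes "u < m" "m \<le> n"
  shows "(real m - real u) * real ((n - u) choose (m - u)) =
    (real n - real u) * real ((n - Suc u) choose (m - Suc u))"
proof -
  have "Suc (m - Suc u) = m - u" "Suc (n - Suc u) = n - u" using assms by auto
  then have "(m - u) * ((n - u) choose (m - u)) = (n - u) * ((n - Suc u) choose (m - Suc u))"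
    using binomial_absorption[of "m - Suc u" "n - u"] assms by simp
  then have "real (m - u) * real ((n - u) choose (m - u)) =
      real (n - u) * real ((n - Suc u) choose (m - Suc u))"
    by (metis of_nat_mult)
  then show ?thesis using assms by (simp add: of_nat_diff)
qed

text \<open>Each further prescribed vertex costs a factor \<open>(m - u) / (n - u)\<close>, which is
  at most \<open>m / n\<close>.\<close>

lemma binomial_diff_le:
  assumes "r \<le> u" "u \<le> m" "m \<le> n"
  shows "real ((n - u) choose (m - u)) \<le> real ((n - r) choose (m - r)) * (real m / real n) ^ (u - r)"
  using assms
proof (induction u rule: dec_induct)
  case base
  then show ?case by simp
next
  case (step u)
  have "real ((n - Suc u) choose (m - Suc u)) =
      (real m - real u) / (real n - real u) * real ((n - u) choose (m - u))"
    using binomial_diff_Suc[of u m n] step by (simp add: field_simps)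
  also have "\<dots> \<le> real m / real n * real ((n - u) choose (m - u))"
  proof (rule mult_right_mono)
    have "real u * real m \<le> real u * real n" using step by (intro mult_left_mono) auto
    then show "(real m - real u) / (real n - real u) \<le> real m / real n"
      using step by (simp add: frac_le_eq divide_le_0_iff field_simps)
  qed simp
  also have "\<dots> \<le> real m / real n * (real ((n - r) choose (m - r)) * (real m / real n) ^ (u - r))"
    using step by (intro mult_left_mono) auto
  also have "\<dots> = real ((n - r) choose (m - r)) * (real m / real n) ^ (Suc u - r)"
    using step by (simp add: Suc_diff_le)
  finally show ?case .
qed

text \<open>Each factor \<open>(n - r) / (m - r)\<close> is at most \<open>2 * n / m\<close>, since
  at most half of the \<open>m\<close> places are prescribed.\<close>

lemma binomial_le_diff:
  assumes "2 * r \<le> m" "m \<le> n"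
  shows "real (n choose m) \<le> real ((n - r) choose (m - r)) * (2 * real n / real m) ^ r"
  using assms
proof (induction r)
  case 0
  then show ?case by simp
next
  case (Suc r)
  have "real (n choose m) \<le> real ((n - r) choose (m - r)) * (2 * real n / real m) ^ r"
    using Suc by simp
  also have "real ((n - r) choose (m - r)) =
      (real n - real r) / (real m - real r) * real ((n - Suc r) choose (m - Suc r))"
    using binomial_diff_Suc[of r m n] Suc.prems by (simp add: field_simps)
  also have "\<dots> \<le> 2 * real n / real m * real ((n - Suc r) choose (m - Suc r))"
  proof (rule mult_right_mono)
    have "(real n - real r) / (real m - real r) \<le> real n / (real m / 2)"
      using Suc.prems by (intro frac_le) auto
    then show "(real n - real r) / (real m - real r) \<le> 2 * real n / real m"
      by (simp add: mult.commute)
  qed simp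
  finally show ?case by (simp add: mult_ac mult_right_mono)
qed

text \<open>A copy is weighted by the number of \<open>m\<close>-sets \<open>W\<close> whose chosen
  disjoint family contains it. The divisor \<open>q\<close> is the number of \<open>m\<close>-sets
  containing a given edge, which brings the degree of a single edge to at most \<open>1\<close>. The
  hypothesis \<open>ex\<close> keeps the uncovered part of the double count below half.\<close>

theorem balanced_supersaturation:
  fixes X :: "nat set"
  assumes H: "uniform_hypergraph r H" "2 \<le> card (edges H)"
    and X: "finite X" "card X = n" and G: "\<And>e. e \<in> G \<Longrightarrow> e \<subseteq> X \<and> card e = r"
    and m: "1 \<le> r" "2 * r \<le> m" "m \<le> n"
    and ex: "real (ex_num r m H) * (2 * real n / real m) ^ r \<le> real (card G) / 2"
    and \<tau>: "(real m / real n) powr (1 / r_density r H) \<le> \<tau>"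
  shows "\<exists>w. balanced G (card (edges H)) (1 / (2 * real (card (edges H)))) \<tau> w \<and>
    (\<forall>D\<subseteq>G. w D \<noteq> 0 \<longrightarrow> is_copy X H D)"
proof -
  define h where "h = card (edges H)"
  define q where "q = real ((n - r) choose (m - r))"
  define \<W> where "\<W> = {W. W \<subseteq> X \<and> card W = m}"
  define GW where "GW = (\<lambda>W. {e\<in>G. e \<subseteq> W})"
  have q: "0 < q" using m by (simp add: q_def)
  have h: "2 \<le> h" using H by (simp add: h_def)
  have fin\<W>: "finite \<W>" using X by (simp add: \<W>_def)
  have finG: "finite G" using G X by (intro finite_subset[of G "Pow X"]) auto
  have "\<exists>P. (\<forall>D\<in>P. D \<subseteq> GW W \<and> is_copy W H D) \<and> pairwise disjnt P \<and>
      card (GW W) \<le> h * card P + ex_num r m H" if "W \<in> \<W>" for W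
  proof -
    have "W \<subseteq> X" "card W = m" using that by (auto simp: \<W>_def)
    moreover have "edges H \<noteq> {}" using H(2) by auto
    ultimately show ?thesis
      using disjoint_copies[OF H(1), of W "GW W"] G finite_subset[OF _ X(1), of W]
      by (simp add: h_def GW_def)
  qed
  then have "\<forall>W\<in>\<W>. \<exists>P. (\<forall>D\<in>P. D \<subseteq> GW W \<and> is_copy W H D) \<and> pairwise disjnt P \<and>
      card (GW W) \<le> h * card P + ex_num r m H"
    by (rule ballI)
  from bchoice[OF this] obtain P where
    P': "\<forall>W\<in>\<W>. (\<forall>D\<in>P W. D \<subseteq> GW W \<and> is_copy W H D) \<and> pairwise disjnt (P W) \<and>
      card (GW W) \<le> h * card (P W) + ex_num r m H"
    by (rule exE)
  have P: "D \<subseteq> GW W \<and> is_copy W H D" if "W \<in> \<W>" "D \<in> P W" for W D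
    using P' that by simp
  have disj: "pairwise disjnt (P W)" and many: "card (GW W) \<le> h * card (P W) + ex_num r m H"
    if "W \<in> \<W>" for W
    using P' that by simp_all
  have PG: "D \<subseteq> G" if "W \<in> \<W>" "D \<in> P W" for W D using P[OF that] by (auto simp: GW_def)
  have finP: "finite (P W)" if "W \<in> \<W>" for W
    using PG that finG by (intro finite_subset[of "P W" "Pow G"]) auto
  define w where "w = (\<lambda>D. real (card {W\<in>\<W>. D \<in> P W}) / q)"
  have w_copy: "is_copy X H D" if "w D \<noteq> 0" for D
  proof -
    have "{W\<in>\<W>. D \<in> P W} \<noteq> {}" using that unfolding w_def by (metis card.empty div_0 of_nat_0)
    then obtain W where W: "W \<in> \<W>" "D \<in> P W" by blast
    then have "W \<subseteq> X" by (simp add: \<W>_def)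
    then show ?thesis using P[OF W] is_copy_mono by blast
  qed
  have wdeg_w: "wdeg G w T = (\<Sum>W\<in>\<W>. real (card {D\<in>P W. T \<subseteq> D})) / q" for T
  proof -
    have "(\<Sum>D | D \<subseteq> G \<and> T \<subseteq> D. real (card {W\<in>\<W>. D \<in> P W})) =
        (\<Sum>D | D \<subseteq> G \<and> T \<subseteq> D. \<Sum>W\<in>\<W>. if D \<in> P W then 1 else 0)"
      using fin\<W> by (simp add: sum.inter_filter[symmetric])
    also have "\<dots> = (\<Sum>W\<in>\<W>. \<Sum>D | D \<subseteq> G \<and> T \<subseteq> D. if D \<in> P W then 1 else 0)"
      by (rule sum.swap)
    also have "\<dots> = (\<Sum>W\<in>\<W>. real (card {D\<in>P W. T \<subseteq> D}))"
    proof (rule sum.cong[OF refl])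
      fix W assume W: "W \<in> \<W>"
      have "{D. D \<subseteq> G \<and> T \<subseteq> D \<and> D \<in> P W} = {D\<in>P W. T \<subseteq> D}" using PG[OF W] by auto
      then show "(\<Sum>D | D \<subseteq> G \<and> T \<subseteq> D. if D \<in> P W then 1 else 0) = real (card {D\<in>P W. T \<subseteq> D})"
        using finG by (simp add: sum.inter_filter[symmetric])
    qed
    finally show ?thesis by (simp add: wdeg_def w_def sum_divide_distrib[symmetric])
  qed
  have deg: "wdeg G w T \<le> \<tau> ^ (card T - 1)" if T: "T \<subseteq> G" "T \<noteq> {}" for T
  proof (cases "\<exists>W\<in>\<W>. \<exists>D\<in>P W. T \<subseteq> D")
    case False
    then have empty: "{D\<in>P W. T \<subseteq> D} = {}" if "W \<in> \<W>" for W using that by blast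
    have "(\<Sum>W\<in>\<W>. real (card {D\<in>P W. T \<subseteq> D})) = 0"
    proof (rule sum.neutral, rule ballI)
      fix W assume "W \<in> \<W>"
      from empty[OF this] show "real (card {D\<in>P W. T \<subseteq> D}) = 0" by (simp only: card.empty of_nat_0)
    qed
    then have "wdeg G w T = 0" by (simp only: wdeg_w div_0)
    moreover have "0 \<le> \<tau>" using \<tau> powr_ge_zero order_trans by blast
    ultimately show ?thesis by simp
  next
    case True
    then obtain W D where WD: "W \<in> \<W>" "D \<in> P W" and TD: "T \<subseteq> D" by blast
    have "W \<subseteq> X" using WD(1) by (simp add: \<W>_def)
    then have D: "is_copy X H D" "T \<subseteq> D" using P[OF WD] is_copy_mono TD by blast+
    define u where "u = card (\<Union>T)"
    define x where "x = real m / real n"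
    have x: "0 < x" "x \<le> 1" using m by (auto simp: x_def)
    have UX: "\<Union>T \<subseteq> X" using T G by blast
    obtain e where e: "e \<in> T" using T by blast
    have "card e = r" using G e T(1) by (meson subsetD)
    moreover have "e \<subseteq> \<Union>T" using e by (rule Union_upper)
    ultimately have ru: "r \<le> u"
      unfolding u_def using card_mono[OF finite_subset[OF UX X(1)]] by metis
    have finT: "finite T" using T finG finite_subset by blast
    \<comment> \<open>All members of \<open>P W\<close> that contain \<open>T\<close> share the edge
      \<open>e\<close>, and distinct members are disjoint.\<close>
    have one: "card {D\<in>P W. T \<subseteq> D} \<le> (if \<Union>T \<subseteq> W then 1 else 0)" if W: "W \<in> \<W>" for W
    proof (cases "\<exists>D\<in>P W. T \<subseteq> D")
      case True
      then obtain D where D: "D \<in> P W" "T \<subseteq> D" by blast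
      have "D' = D" if "D' \<in> P W" "T \<subseteq> D'" for D'
      proof (rule ccontr)
        assume "D' \<noteq> D"
        then have "disjnt D' D" using disj[OF W] D(1) that(1) by (meson pairwiseD)
        moreover have "e \<in> D'" "e \<in> D" using e D(2) that(2) by auto
        ultimately show False by (auto simp: disjnt_def)
      qed
      then have "{D\<in>P W. T \<subseteq> D} \<subseteq> {D}" by blast
      then have "card {D\<in>P W. T \<subseteq> D} \<le> card {D}" by (rule card_mono[rotated]) simp
      moreover have "D \<subseteq> GW W" using P[OF W D(1)] by blast
      then have "\<Union>T \<subseteq> W" using D(2) unfolding GW_def by blast
      ultimately show ?thesis by simp
    next
      case False
      then have "{D\<in>P W. T \<subseteq> D} = {}" by blast
      then show ?thesis by (simp only: card.empty)
    qed
    have "(\<Sum>W\<in>\<W>. real (card {D\<in>P W. T \<subseteq> D})) \<le> (\<Sum>W\<in>\<W>. if \<Union>T \<subseteq> W then 1 else 0)"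
    proof (rule sum_mono)
      fix W assume "W \<in> \<W>"
      from one[OF this] show "real (card {D\<in>P W. T \<subseteq> D}) \<le> (if \<Union>T \<subseteq> W then 1 else 0)"
        by (cases "\<Union>T \<subseteq> W") (simp_all only: if_True if_False of_nat_le_1_iff of_nat_le_0_iff le_zero_eq of_nat_0)
    qed
    also have "\<dots> = real (card {W. W \<subseteq> X \<and> card W = m \<and> \<Union>T \<subseteq> W})"
      using fin\<W> by (simp add: sum.inter_filter[symmetric] \<W>_def conj_assoc)
    also have "\<dots> \<le> q * x ^ (u - r)"
      unfolding card_supersets_of_size[OF X(1) UX] u_def[symmetric] X(2)
      using binomial_diff_le[OF ru, of m n] m q x by (auto simp: q_def x_def)
    finally have "wdeg G w T \<le> x ^ (u - r)"
      unfolding wdeg_w using q by (simp add: pos_divide_le_eq mult.commute)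
    also have "\<dots> \<le> \<tau> ^ (card T - 1)"
    \<comment> \<open>The density bound concerns at least two edges; for one edge the claim is that
      \<open>x ^ (u - r)\<close> is at most \<open>1\<close>.\<close>
    proof (cases "card T = 1")
      case True
      then show ?thesis using x by (simp add: power_le_one)
    next
      case False
      then have T2: "2 \<le> card T" using T finT by (cases "card T") auto
      have \<mu>: "0 < r_density r H" using r_density_bounds[OF H] by simp
      have "(real (card T) - 1) / r_density r H \<le> real u - real r"
        using span_of_copy_subset[OF H(1) D T2] \<mu> by (simp add: u_def pos_divide_le_eq mult.commute)
      then have "x powr (real u - real r) \<le> x powr ((real (card T) - 1) / r_density r H)"
        using x by (intro powr_mono') auto
      also have "\<dots> = (x powr (1 / r_density r H)) ^ (card T - 1)"
        using x T2 by (simp add: powr_realpow[symmetric] powr_powr of_nat_diff)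
      also have "\<dots> \<le> \<tau> ^ (card T - 1)" using \<tau> by (intro power_mono) (auto simp: x_def)
      finally show ?thesis using x ru by (simp add: powr_realpow[symmetric] of_nat_diff)
    qed
    finally show ?thesis .
  qed
  have tot: "1 / (2 * real h) * real (card G) \<le> wdeg G w {}"
  proof -
    \<comment> \<open>Pairs of an edge and an \<open>m\<close>-set containing it are counted in two
      ways.\<close>
    have "real (card G) * q = (\<Sum>e\<in>G. real (card {W. W \<subseteq> X \<and> card W = m \<and> e \<subseteq> W}))"
      using G m X by (simp add: card_supersets_of_size q_def)
    also have "\<dots> = (\<Sum>e\<in>G. \<Sum>W\<in>\<W>. if e \<subseteq> W then 1 else 0)"
      using fin\<W> by (simp add: sum.inter_filter[symmetric] \<W>_def conj_assoc)
    also have "\<dots> = (\<Sum>W\<in>\<W>. \<Sum>e\<in>G. if e \<subseteq> W then 1 else 0)" by (rule sum.swap)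
    also have "\<dots> = (\<Sum>W\<in>\<W>. real (card (GW W)))"
      using finG by (simp add: sum.inter_filter[symmetric] GW_def)
    also have "\<dots> \<le> (\<Sum>W\<in>\<W>. real h * real (card (P W)) + real (ex_num r m H))"
      using many by (intro sum_mono) (metis of_nat_add of_nat_le_iff of_nat_mult)
    also have "\<dots> = real h * (\<Sum>W\<in>\<W>. real (card (P W))) + real (ex_num r m H) * real (n choose m)"
      using X by (simp add: sum.distrib sum_distrib_left \<W>_def n_subsets)
    also have "real (ex_num r m H) * real (n choose m)
        \<le> real (ex_num r m H) * (q * (2 * real n / real m) ^ r)"
      using binomial_le_diff[OF m(2,3)] by (intro mult_left_mono) (auto simp: q_def)
    also have "\<dots> = q * (real (ex_num r m H) * (2 * real n / real m) ^ r)" by simp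
    also have "\<dots> \<le> q * (real (card G) / 2)" using ex q by (intro mult_left_mono) auto
    also have "(\<Sum>W\<in>\<W>. real (card (P W))) = q * wdeg G w {}" using q by (simp add: wdeg_w)
    finally have "q * (real (card G) / 2) \<le> q * (real h * wdeg G w {})" by (simp add: algebra_simps)
    then have "real (card G) / 2 \<le> real h * wdeg G w {}" using q by simp
    then show ?thesis using h by (simp add: field_simps)
  qed
  have "balanced G h (1 / (2 * real h)) \<tau> w"
    unfolding balanced_def
  proof (intro conjI)
    show "\<forall>e. 0 \<le> w e" using q by (simp add: w_def)
    show "\<forall>D\<subseteq>G. w D \<noteq> 0 \<longrightarrow> card D = h" using w_copy card_copy[OF H(1)] by (auto simp: h_def)
  qed (use deg tot in auto)
  then show ?thesis using w_copy by (auto simp: h_def)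
qed

section \<open>Counting\<close>

text \<open>With \<open>k = |G|/x\<close>, the induction bounds the exponent for \<open>G\<close> by \<open>x (D - E max(k, K')^(-\<gamma>))\<close>: \<open>E\<close> is
  chosen such that the gain from \<open>k\<close> to \<open>(1 - \<delta>) k\<close> pays exactly for the number of containers.\<close>

lemma card_subsets_le_by_containers:
  assumes fin: "finite U" and "0 < x" "0 < K" "0 < \<delta>" "\<delta> < 1" "0 < \<gamma>" "0 \<le> B"
    and step: "\<And>G. G \<subseteq> U \<Longrightarrow> K * x \<le> real (card G) \<Longrightarrow>
      \<exists>\<C>. finite \<C> \<and> real (card \<C>) \<le> exp (B * x * (real (card G) / x) powr - \<gamma>) \<and>
        (\<forall>C\<in>\<C>. C \<subseteq> G \<and> real (card C) \<le> (1 - \<delta>) * real (card G)) \<and>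
        (\<forall>I\<subseteq>G. Q I \<longrightarrow> (\<exists>C\<in>\<C>. I \<subseteq> C))"
  shows "real (card {I. I \<subseteq> U \<and> Q I})
    \<le> exp (x * (K + B / ((1 - \<delta>) powr - \<gamma> - 1) * ((1 - \<delta>) * K) powr - \<gamma>))"
proof -
  define E where "E = B / ((1 - \<delta>) powr - \<gamma> - 1)"
  define K' where "K' = (1 - \<delta>) * K"
  define D where "D = K + E * K' powr - \<gamma>"
  \<comment> \<open>A container may be far smaller than \<open>(1 - \<delta>) * card G\<close>. The
    truncation at \<open>K'\<close> keeps \<open>\<phi>\<close> bounded and nonincreasing there and
    avoids the default \<open>0 powr - \<gamma> = 0\<close>; the values
    \<open>(1 - \<delta>) * k\<close> with \<open>K \<le> k\<close> are unaffected by it.\<close>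
  define \<phi> where "\<phi> = (\<lambda>k. max k K' powr - \<gamma>)"
  have K': "0 < K'" "K' \<le> K" using assms by (auto simp: K'_def mult_le_cancel_right1)
  have "(1 - \<delta>) powr 0 < (1 - \<delta>) powr - \<gamma>"
    using assms by (intro powr_less_mono') auto
  then have den: "0 < (1 - \<delta>) powr - \<gamma> - 1" using assms by simp
  then have E0: "0 \<le> E" using assms by (simp add: E_def)
  have main: "real (card {I. I \<subseteq> G \<and> Q I}) \<le> exp (x * (D - E * \<phi> (real (card G) / x)))"
    if "G \<subseteq> U" for G
    using that
  proof (induction "card G" arbitrary: G rule: less_induct)
    case less
    have finG: "finite G" using less.prems fin finite_subset by blast
    define k where "k = real (card G) / x"
    have cardG: "real (card G) = k * x" using assms by (simp add: k_def)
    show ?case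
    proof (cases "K * x \<le> real (card G)")
      case False
      \<comment> \<open>Below the threshold all subsets are counted; \<open>D\<close> is chosen such
        that \<open>D - E * \<phi> k\<close> is still at least \<open>K\<close>.\<close>
      have "card {I. I \<subseteq> G \<and> Q I} \<le> card (Pow G)" using finG by (intro card_mono) auto
      then have "real (card {I. I \<subseteq> G \<and> Q I}) \<le> 2 ^ card G"
        using finG by (simp add: card_Pow flip: of_nat_le_iff)
      also have "\<dots> \<le> exp 1 ^ card G" using exp_ge_add_one_self[of 1] by (intro power_mono) auto
      also have "\<dots> = exp (real (card G))" by (simp add: exp_of_nat_mult[symmetric])
      also have "\<dots> \<le> exp (x * (D - E * \<phi> k))"
      proof -
        have "\<phi> k \<le> K' powr - \<gamma>"
          unfolding \<phi>_def using assms K' by (intro powr_mono2') auto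
        then have "E * \<phi> k \<le> E * K' powr - \<gamma>" using E0 by (rule mult_left_mono)
        then have "x * K \<le> x * (D - E * \<phi> k)" using assms by (simp add: D_def)
        then show ?thesis using False by (simp add: mult.commute)
      qed
      finally show ?thesis by (simp add: k_def)
    next
      case True
      have k: "K \<le> k" using True assms by (simp add: k_def pos_le_divide_eq)
      obtain \<C> where \<C>: "finite \<C>" "real (card \<C>) \<le> exp (B * x * k powr - \<gamma>)"
        "\<And>C. C \<in> \<C> \<Longrightarrow> C \<subseteq> G \<and> real (card C) \<le> (1 - \<delta>) * real (card G)"
        "\<And>I. I \<subseteq> G \<Longrightarrow> Q I \<Longrightarrow> \<exists>C\<in>\<C>. I \<subseteq> C"
        using step[OF less.prems True] unfolding k_def by metis
      let ?b = "exp (x * (D - E * ((1 - \<delta>) * k) powr - \<gamma>))"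
      have each: "real (card {I. I \<subseteq> C \<and> Q I}) \<le> ?b" if C: "C \<in> \<C>" for C
      proof -
        have "0 < real (card G)" using True assms by (smt (verit) mult_pos_pos)
        then have "(1 - \<delta>) * real (card G) < real (card G)" using assms by simp
        then have "card C < card G" using \<C>(3)[OF C] by linarith
        moreover have "C \<subseteq> U" using \<C>(3)[OF C] less.prems by blast
        ultimately have "real (card {I. I \<subseteq> C \<and> Q I}) \<le> exp (x * (D - E * \<phi> (real (card C) / x)))"
          by (rule less.hyps)
        also have "\<dots> \<le> ?b"
        proof -
          have "real (card C) / x \<le> (1 - \<delta>) * k"
            using \<C>(3)[OF C] assms by (simp add: cardG pos_divide_le_eq mult.assoc)
          moreover have "K' \<le> (1 - \<delta>) * k"
            unfolding K'_def using k assms by (intro mult_left_mono) auto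
          ultimately have "((1 - \<delta>) * k) powr - \<gamma> \<le> \<phi> (real (card C) / x)"
            unfolding \<phi>_def using assms K' by (intro powr_mono2') auto
          then have "E * ((1 - \<delta>) * k) powr - \<gamma> \<le> E * \<phi> (real (card C) / x)"
            using E0 by (rule mult_left_mono)
          then show ?thesis using assms by simp
        qed
        finally show ?thesis .
      qed
      have "{I. I \<subseteq> G \<and> Q I} \<subseteq> (\<Union>C\<in>\<C>. {I. I \<subseteq> C \<and> Q I})" using \<C>(4) by blast
      moreover have "finite (\<Union>C\<in>\<C>. {I. I \<subseteq> C \<and> Q I})"
      proof (rule finite_UN_I[OF \<C>(1)])
        fix C assume "C \<in> \<C>"
        then have "finite C" using \<C>(3) finG finite_subset by metis
        then show "finite {I. I \<subseteq> C \<and> Q I}" by simp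
      qed
      ultimately have "card {I. I \<subseteq> G \<and> Q I} \<le> card (\<Union>C\<in>\<C>. {I. I \<subseteq> C \<and> Q I})"
        by (rule card_mono[rotated])
      also have "\<dots> \<le> (\<Sum>C\<in>\<C>. card {I. I \<subseteq> C \<and> Q I})" by (rule card_UN_le[OF \<C>(1)])
      finally have "card {I. I \<subseteq> G \<and> Q I} \<le> (\<Sum>C\<in>\<C>. card {I. I \<subseteq> C \<and> Q I})" .
      from of_nat_mono[OF this, where 'a = real]
      have "real (card {I. I \<subseteq> G \<and> Q I}) \<le> (\<Sum>C\<in>\<C>. real (card {I. I \<subseteq> C \<and> Q I}))"
        by (simp only: of_nat_sum)
      also have "\<dots> \<le> real (card \<C>) * ?b" using each by (rule sum_bounded_above)
      also have "\<dots> \<le> exp (B * x * k powr - \<gamma>) * ?b" using \<C>(2) by (intro mult_right_mono) auto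
      also have "\<dots> = exp (x * (D - E * k powr - \<gamma>))"
      proof -
        have scale: "((1 - \<delta>) * k) powr - \<gamma> = (1 - \<delta>) powr - \<gamma> * k powr - \<gamma>"
          by (rule powr_mult)
        have "E * ((1 - \<delta>) powr - \<gamma> - 1) = B" using den by (simp add: E_def)
        then have B: "B = E * (1 - \<delta>) powr - \<gamma> - E" by (simp add: algebra_simps)
        have "B * x * k powr - \<gamma> + x * (D - E * ((1 - \<delta>) * k) powr - \<gamma>)
            = x * (D - E * k powr - \<gamma>)"
          unfolding scale by (subst B) (simp add: algebra_simps)
        then show ?thesis by (simp add: exp_add[symmetric])
      qed
      also have "k powr - \<gamma> = \<phi> k" using k K' by (simp add: \<phi>_def max_absorb1)
      finally show ?thesis by (simp add: k_def)
    qed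
  qed
  have "real (card {I. I \<subseteq> U \<and> Q I}) \<le> exp (x * (D - E * \<phi> (real (card U) / x)))"
    by (rule main) simp
  also have "\<dots> \<le> exp (x * D)" using assms E0 by (simp add: \<phi>_def)
  finally show ?thesis by (simp add: D_def E_def K'_def)
qed

text \<open>With \<open>y = 1 / \<tau> \<ge> 1\<close>, the estimates
  \<open>ln y \<le> y powr \<zeta> / \<zeta>\<close> and \<open>1 \<le> y powr \<zeta>\<close>
  absorb the logarithm into a small power of \<tau>.\<close>

lemma card_small_sets_powr:
  assumes "finite V" "0 < \<tau>" "\<tau> \<le> 1" "0 < \<zeta>"
  shows "real (card (small_sets V (\<tau> * real (card V))))
    \<le> exp ((1 + 1 / \<zeta>) * (real (card V) * \<tau> powr (1 - \<zeta>)))"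
proof -
  have "1 + ln (1 / \<tau>) \<le> (1 + 1 / \<zeta>) * (1 / \<tau>) powr \<zeta>"
    using ln_powr_bound[of "1 / \<tau>" \<zeta>] ge_one_powr_ge_zero[of "1 / \<tau>" \<zeta>] assms
    by (simp add: algebra_simps)
  also have "(1 / \<tau>) powr \<zeta> = \<tau> powr - \<zeta>" using assms by (simp add: powr_divide powr_minus_divide)
  finally have "\<tau> * (1 + ln (1 / \<tau>)) \<le> \<tau> * ((1 + 1 / \<zeta>) * \<tau> powr - \<zeta>)"
    using assms by (intro mult_left_mono) auto
  also have "\<dots> = (1 + 1 / \<zeta>) * \<tau> powr (1 - \<zeta>)"
    using assms by (simp add: powr_diff powr_minus_divide)
  finally have "real (card V) * (\<tau> * (1 + ln (1 / \<tau>)))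
      \<le> real (card V) * ((1 + 1 / \<zeta>) * \<tau> powr (1 - \<zeta>))"
    by (rule mult_left_mono) simp
  then have "\<tau> * real (card V) * (1 + ln (1 / \<tau>))
      \<le> (1 + 1 / \<zeta>) * (real (card V) * \<tau> powr (1 - \<zeta>))" by (simp add: mult_ac)
  then show ?thesis using card_small_sets[OF assms(1-3)] by (meson exp_le_cancel_iff order_trans)
qed


section \<open>Parameters of one container step\<close>

text \<open>Here \<open>s\<close> stands for \<open>r - \<alpha>\<close> and \<open>\<mu>\<close>
  for the density. The choice is \<open>n * y\<close> rounded up, with
  \<open>y powr s = A\<^sub>1 / k\<close>. From \<open>k \<le> n powr s\<close> follows
  \<open>2 * r \<le> n * y\<close>, and from \<open>A\<^sub>1 \<le> k\<close> follows
  \<open>y \<le> 1\<close>, hence \<open>m \<le> n\<close>. Rounding up at most doubles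
  \<open>n * y\<close>.\<close>

lemma sample_size:
  fixes n :: nat and s \<rho> \<mu> k A\<^sub>1 :: real
  assumes "1 \<le> n" "0 < s" "0 < \<mu>" and k: "A\<^sub>1 \<le> k" "k \<le> real n powr s"
    and A1: "1 \<le> A\<^sub>1" "(2 * real r) powr s \<le> A\<^sub>1" and "1 \<le> r"
  obtains m :: nat where "2 * r \<le> m" "m \<le> n" "real m powr - s \<le> k * real n powr - s / A\<^sub>1"
    "(real m / real n) powr (1 / \<mu>)
      \<le> (2 * A\<^sub>1 powr (1 / s)) powr (1 / \<mu>) * k powr - (1 / (s * \<mu>))"
proof -
  define y where "y = (A\<^sub>1 / k) powr (1 / s)"
  define m where "m = nat \<lceil>real n * y\<rceil>"
  have k0: "0 < k" using k A1 by linarith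
  have y0: "0 < y" using k0 A1 by (simp add: y_def)
  have y1: "y \<le> 1"
    unfolding y_def using k k0 A1 assms by (intro powr_le1) auto
  have ys: "y powr s = A\<^sub>1 / k" using k0 A1 assms by (simp add: y_def powr_powr)
  have "(2 * real r) powr s \<le> A\<^sub>1 / k * real n powr s"
  proof -
    have "A\<^sub>1 / k * k \<le> A\<^sub>1 / k * real n powr s" using k k0 A1 by (intro mult_left_mono) auto
    then show ?thesis using A1 k0 by simp
  qed
  also have "\<dots> = (real n * y) powr s" using ys by (simp add: powr_mult mult.commute)
  finally have "2 * real r \<le> real n * y"
    using powr_less_mono2[of s "real n * y" "2 * real r"] assms(2) y0 by (smt (verit) mult_nonneg_nonneg of_nat_0_le_iff)
  then have ny: "2 * real r \<le> real n * y" "1 \<le> real n * y" using assms by auto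
  have m: "real n * y \<le> real m" "real m < real n * y + 1"
    unfolding m_def using ny by linarith+
  have "real n * y \<le> real n" using y1 by (simp add: mult_left_le)
  then have mn: "m \<le> n" using m(2) by linarith
  have "real m \<le> 2 * (real n * y)" using m(2) ny by linarith
  then have m2: "real m / real n \<le> 2 * y" using assms(1) by (simp add: pos_divide_le_eq mult_ac)
  have "real m powr - s \<le> (real n * y) powr - s"
    using m ny assms by (intro powr_mono2') auto
  also have "\<dots> = real n powr - s * y powr - s" by (rule powr_mult)
  also have "y powr - s = k / A\<^sub>1" using ys k0 A1 by (simp add: powr_minus)
  finally have 1: "real m powr - s \<le> k * real n powr - s / A\<^sub>1" by (simp add: mult.commute)
  have "(real m / real n) powr (1 / \<mu>) \<le> (2 * y) powr (1 / \<mu>)"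
    using m2 assms by (intro powr_mono2) auto
  also have "2 * y = (2 * A\<^sub>1 powr (1 / s)) * k powr - (1 / s)"
    using k0 A1 by (simp add: y_def powr_divide powr_minus_divide)
  also have "((2 * A\<^sub>1 powr (1 / s)) * k powr - (1 / s)) powr (1 / \<mu>)
      = (2 * A\<^sub>1 powr (1 / s)) powr (1 / \<mu>) * (k powr - (1 / s)) powr (1 / \<mu>)"
    by (rule powr_mult)
  also have "(k powr - (1 / s)) powr (1 / \<mu>) = k powr - (1 / (s * \<mu>))" by (simp add: powr_powr)
  finally have 2: "(real m / real n) powr (1 / \<mu>)
      \<le> (2 * A\<^sub>1 powr (1 / s)) powr (1 / \<mu>) * k powr - (1 / (s * \<mu>))" .
  show thesis using that[of m] 1 2 mn m(1) ny(1) by simp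
qed

lemma card_uniform_le:
  assumes "\<And>e. e \<in> G \<Longrightarrow> e \<subseteq> {1..n::nat} \<and> card e = r"
  shows "card G \<le> n ^ r"
proof -
  have "card G \<le> card {e. e \<subseteq> {1..n} \<and> card e = r}" using assms by (intro card_mono) auto
  also have "\<dots> = n choose r" by (simp add: n_subsets)
  also have "\<dots> \<le> n ^ r" by (cases "r \<le> n") (auto simp: binomial_le_pow binomial_eq_0)
  finally show ?thesis .
qed

text \<open>One round of shrinking: the supersaturation weight is fed into \<open>containers\<close>
  with \<open>\<tau> = B\<^sub>1 * k powr - \<rho>\<close>, where
  \<open>k = card G / n powr \<alpha>\<close>. Because \<open>\<rho> > 1\<close>, the exponent
  decays in \<open>k\<close> even after paying for the logarithm.\<close>

lemma containers_for_free_hypergraphs: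
  fixes H :: "'a hypergraph"
  assumes H: "uniform_hypergraph r H" "2 \<le> card (edges H)"
    and \<alpha>: "0 < \<alpha>" "\<alpha> < real r" "real r - 1 / r_density r H < \<alpha>" and A: "0 < A"
    and ex: "\<And>n. real (ex_num r n H) \<le> A * real n powr \<alpha>"
  shows "\<exists>K>0. \<exists>\<delta>>0. \<delta> < 1 \<and> (\<exists>\<gamma>>0. \<exists>B\<ge>0. \<forall>n\<ge>1. \<forall>G.
    (\<forall>e\<in>G. e \<subseteq> {1..n} \<and> card e = r) \<longrightarrow> K * real n powr \<alpha> \<le> real (card G) \<longrightarrow>
    (\<exists>\<C>. finite \<C> \<and>
      real (card \<C>) \<le> exp (B * real n powr \<alpha> * (real (card G) / real n powr \<alpha>) powr - \<gamma>) \<and>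
      (\<forall>C\<in>\<C>. C \<subseteq> G \<and> real (card C) \<le> (1 - \<delta>) * real (card G)) \<and>
      (\<forall>I\<subseteq>G. \<not> contains_copy ({1..n}, I) H \<longrightarrow> (\<exists>C\<in>\<C>. I \<subseteq> C))))"
proof -
  define \<mu> where "\<mu> = r_density r H"
  define h where "h = card (edges H)"
  define s where "s = real r - \<alpha>"
  define \<rho> where "\<rho> = 1 / (s * \<mu>)"
  \<comment> \<open>The first term makes \<open>ex_num r m H\<close> small enough for
    supersaturation, the second ensures \<open>2 * r \<le> m\<close>.\<close>
  define A\<^sub>1 where "A\<^sub>1 = max (A * 2 ^ (r + 1)) ((2 * real r) powr s)"
  define B\<^sub>1 where "B\<^sub>1 = (2 * A\<^sub>1 powr (1 / s)) powr (1 / \<mu>)"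
  \<comment> \<open>The logarithm in the number of fingerprints costs a factor \<open>\<tau>^(-\<zeta>)\<close>;
    \<open>\<rho> (1 - \<zeta>) = 1 + \<gamma>\<close> leaves half of the excess of \<open>\<rho>\<close> over \<open>1\<close>.\<close>
  define \<gamma> where "\<gamma> = (\<rho> - 1) / 2"
  define \<zeta> where "\<zeta> = (\<rho> - 1) / (2 * \<rho>)"
  define B where "B = real (h - 1) * ((1 + 1 / \<zeta>) * B\<^sub>1 powr (1 - \<zeta>))"
  have \<mu>: "0 < \<mu>" "1 \<le> real r * \<mu>" using r_density_bounds[OF H] by (auto simp: \<mu>_def)
  have h: "2 \<le> h" using H by (simp add: h_def)
  have r: "1 \<le> r" using \<alpha> by linarith
  have s: "0 < s" using \<alpha> by (simp add: s_def)
  have "s < 1 / \<mu>" using \<alpha> by (simp add: s_def \<mu>_def)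
  then have "s * \<mu> < 1" using \<mu> by (simp add: pos_less_divide_eq)
  then have \<rho>: "1 < \<rho>" using s \<mu> by (simp add: \<rho>_def)
  then have \<zeta>: "0 < \<zeta>" "\<rho> * (1 - \<zeta>) = 1 + \<gamma>" and \<gamma>: "0 < \<gamma>"
    by (auto simp: \<zeta>_def \<gamma>_def field_simps)
  have "1 \<le> (2 * real r) powr s" using r s by (intro ge_one_powr_ge_zero) auto
  then have A1: "1 \<le> A\<^sub>1" "(2 * real r) powr s \<le> A\<^sub>1" "A * 2 ^ (r + 1) \<le> A\<^sub>1"
    unfolding A\<^sub>1_def by linarith+
  have "1 \<le> A\<^sub>1 powr (1 / s)" using A1 s by (intro ge_one_powr_ge_zero) auto
  then have B1: "1 \<le> B\<^sub>1" unfolding B\<^sub>1_def using \<mu> by (intro ge_one_powr_ge_zero) auto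
  obtain \<delta> \<tau>\<^sub>0 where \<delta>: "0 < \<delta>" and \<tau>\<^sub>0: "0 < \<tau>\<^sub>0" and cont: "\<And>(V :: nat set set) \<tau> w.
      finite V \<Longrightarrow> 0 < \<tau> \<Longrightarrow> \<tau> \<le> \<tau>\<^sub>0 \<Longrightarrow> 1 \<le> \<tau> * real (card V) \<Longrightarrow>
      balanced V h (1 / (2 * real h)) \<tau> w \<Longrightarrow>
      \<exists>\<C>. finite \<C> \<and> card \<C> \<le> card (small_sets V (\<tau> * real (card V))) ^ (h - 1) \<and>
        container_family V w \<delta> \<C>"
    using containers[of h "1 / (2 * real h)", where 'e = "nat set"] h by auto
  define \<tau>\<^sub>1 where "\<tau>\<^sub>1 = min \<tau>\<^sub>0 1"
  \<comment> \<open>The first term is required by \<open>sample_size\<close>, the second forces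
    \<open>\<tau> \<le> \<tau>\<^sub>1\<close>. The cap in the next line ensures
    \<open>\<delta>' < 1\<close>.\<close>
  define K where "K = max A\<^sub>1 ((B\<^sub>1 / \<tau>\<^sub>1) powr (1 / \<rho>))"
  define \<delta>' where "\<delta>' = min \<delta> (1 / 2)"
  have \<tau>\<^sub>1: "0 < \<tau>\<^sub>1" using \<tau>\<^sub>0 by (simp add: \<tau>\<^sub>1_def)
  have K0: "0 < K" using A1 by (auto simp: K_def)
  have main: "\<exists>\<C>. finite \<C> \<and>
      real (card \<C>) \<le> exp (B * real n powr \<alpha> * (real (card G) / real n powr \<alpha>) powr - \<gamma>) \<and>
      (\<forall>C\<in>\<C>. C \<subseteq> G \<and> real (card C) \<le> (1 - \<delta>') * real (card G)) \<and>
      (\<forall>I\<subseteq>G. \<not> contains_copy ({1..n}, I) H \<longrightarrow> (\<exists>C\<in>\<C>. I \<subseteq> C))"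
    if n: "1 \<le> n" and G: "\<forall>e\<in>G. e \<subseteq> {1..n} \<and> card e = r"
      and large: "K * real n powr \<alpha> \<le> real (card G)" for n :: nat and G
  proof -
    define x where "x = real n powr \<alpha>"
    define k where "k = real (card G) / x"
    define \<tau> where "\<tau> = B\<^sub>1 * k powr - \<rho>"
    have x: "0 < x" using n by (simp add: x_def)
    have N: "real (card G) = k * x" using x by (simp add: k_def)
    have kK: "K \<le> k" using large x by (simp add: k_def x_def pos_le_divide_eq)
    have k0: "0 < k" and kA: "A\<^sub>1 \<le> k" using kK K0 by (auto simp: K_def)
    have finG: "finite G" using G by (intro finite_subset[of G "Pow {1..n}"]) auto
    have ns: "real n powr s * x = real n ^ r"
      using n by (simp add: x_def s_def powr_add[symmetric] powr_realpow)
    \<comment> \<open>The trivial bound on the number of edges gives the upper end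
      \<open>n powr s\<close> of the range of \<open>k\<close>.\<close>
    have "real (card G) \<le> real n ^ r"
      using card_uniform_le[of G n r] G by (metis of_nat_le_iff of_nat_power)
    then have "k * x \<le> real n powr s * x" using ns by (simp add: N)
    then have kn: "k \<le> real n powr s" using x by (rule mult_right_le_imp_le)
    obtain m where m: "2 * r \<le> m" "m \<le> n" "real m powr - s \<le> k * real n powr - s / A\<^sub>1"
      and m\<tau>: "(real m / real n) powr (1 / \<mu>) \<le> \<tau>"
      using sample_size[OF n s \<mu>(1) kA kn A1(1,2) r] unfolding \<tau>_def B\<^sub>1_def \<rho>_def by blast
    have exm: "real (ex_num r m H) * (2 * real n / real m) ^ r \<le> real (card G) / 2"
    proof -
      have m0: "0 < real m" using m r by simp
      have "real m powr \<alpha> * (2 * real n / real m) ^ r = 2 ^ r * real n ^ r * real m powr - s"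
        using m0 by (simp add: power_divide power_mult_distrib powr_realpow[symmetric] s_def powr_diff)
      also have "\<dots> \<le> 2 ^ r * real n ^ r * (k * real n powr - s / A\<^sub>1)"
        using m(3) by (intro mult_left_mono) auto
      also have "\<dots> = 2 ^ r / A\<^sub>1 * (k * x)"
        using n by (simp add: ns[symmetric] powr_minus)
      finally have *: "real m powr \<alpha> * (2 * real n / real m) ^ r \<le> 2 ^ r / A\<^sub>1 * (k * x)" .
      have "real (ex_num r m H) * (2 * real n / real m) ^ r
          \<le> A * real m powr \<alpha> * (2 * real n / real m) ^ r"
        using ex[of m] by (intro mult_right_mono) auto
      also have "\<dots> \<le> A * (2 ^ r / A\<^sub>1 * (k * x))"
        using mult_left_mono[OF *, of A] A by (simp add: mult.assoc)
      also have "\<dots> = (A * 2 ^ (r + 1)) / A\<^sub>1 * (k * x / 2)" by simp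
      also have "\<dots> \<le> 1 * (k * x / 2)"
        using A1 k0 x by (intro mult_right_mono) (auto simp: divide_le_eq_1)
      finally show ?thesis by (simp add: N)
    qed
    obtain w where w: "balanced G h (1 / (2 * real h)) \<tau> w"
      "\<And>D. D \<subseteq> G \<Longrightarrow> w D \<noteq> 0 \<Longrightarrow> is_copy {1..n} H D"
      using balanced_supersaturation[OF H _ _ _ r m(1,2) exm, of "{1..n}" \<tau>] G m\<tau>
      unfolding h_def \<mu>_def by auto
    have \<tau>0: "0 < \<tau>" using B1 k0 by (simp add: \<tau>_def)
    have \<tau>1: "\<tau> \<le> \<tau>\<^sub>1"
    proof -
      have "((B\<^sub>1 / \<tau>\<^sub>1) powr (1 / \<rho>)) powr \<rho> \<le> k powr \<rho>"
        using kK \<rho> by (intro powr_mono2) (auto simp: K_def)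
      then have "B\<^sub>1 / \<tau>\<^sub>1 \<le> k powr \<rho>" using \<rho> B1 \<tau>\<^sub>1 by (simp add: powr_powr)
      then show ?thesis using k0 \<tau>\<^sub>1 by (simp add: \<tau>_def powr_minus_divide field_simps)
    qed
    have \<tau>N: "1 \<le> \<tau> * real (card G)"
    proof -
      \<comment> \<open>Since \<open>\<rho> > 1\<close>, the expression
        \<open>k powr (1 - \<rho>) * x\<close> is smallest at \<open>k = n powr s\<close>, where it
        equals \<open>n powr (r - 1 / \<mu>)\<close>.\<close>
      have "1 \<le> real n powr (real r - 1 / \<mu>)"
        using n \<mu> by (intro ge_one_powr_ge_zero) (auto simp: pos_divide_le_eq mult.commute)
      also have "real r - 1 / \<mu> = s * (1 - \<rho>) + \<alpha>"
        using s \<mu> by (simp add: s_def \<rho>_def right_diff_distrib)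
      also have "real n powr (s * (1 - \<rho>) + \<alpha>) = (real n powr s) powr (1 - \<rho>) * x"
        by (simp add: powr_add powr_powr x_def)
      also have "\<dots> \<le> k powr (1 - \<rho>) * x"
        using kn k0 \<rho> x by (intro mult_right_mono powr_mono2') auto
      also have "\<dots> = k powr - \<rho> * real (card G)"
        using k0 by (simp add: N powr_diff powr_minus_divide)
      also have "\<dots> \<le> B\<^sub>1 * (k powr - \<rho> * real (card G))"
        using mult_right_mono[OF B1, of "k powr - \<rho> * real (card G)"] by simp
      finally show ?thesis by (simp add: \<tau>_def mult.assoc)
    qed
    obtain \<C> where \<C>: "finite \<C>" "card \<C> \<le> card (small_sets G (\<tau> * real (card G))) ^ (h - 1)"
      "container_family G w \<delta> \<C>"
      using cont[OF finG \<tau>0 _ \<tau>N w(1)] \<tau>1 by (auto simp: \<tau>\<^sub>1_def)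
    have "real (card \<C>) \<le> real (card (small_sets G (\<tau> * real (card G)))) ^ (h - 1)"
      using \<C>(2) by (metis of_nat_le_iff of_nat_power)
    also have "\<dots> \<le> exp ((1 + 1 / \<zeta>) * (real (card G) * \<tau> powr (1 - \<zeta>))) ^ (h - 1)"
      using card_small_sets_powr[OF finG \<tau>0 _ \<zeta>(1)] \<tau>1 by (intro power_mono) (auto simp: \<tau>\<^sub>1_def)
    also have "\<dots> = exp (real (h - 1) * ((1 + 1 / \<zeta>) * (real (card G) * \<tau> powr (1 - \<zeta>))))"
      by (rule exp_of_nat_mult[symmetric])
    also have "real (card G) * \<tau> powr (1 - \<zeta>) = B\<^sub>1 powr (1 - \<zeta>) * (x * k powr - \<gamma>)"
    proof -
      have "\<tau> powr (1 - \<zeta>) = B\<^sub>1 powr (1 - \<zeta>) * k powr (- \<rho> * (1 - \<zeta>))"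
        by (simp add: \<tau>_def powr_mult powr_powr)
      \<comment> \<open>The factor \<open>k\<close> in \<open>card G = k * x\<close> cancels the
        \<open>- 1\<close>, which leaves the exponent \<open>- \<gamma>\<close>.\<close>
      also have "- \<rho> * (1 - \<zeta>) = - \<gamma> - 1" using \<zeta>(2) by simp
      also have "k powr (- \<gamma> - 1) = k powr - \<gamma> / k" using k0 by (simp add: powr_diff)
      finally show ?thesis using k0 by (simp add: N)
    qed
    also have "real (h - 1) * ((1 + 1 / \<zeta>) * (B\<^sub>1 powr (1 - \<zeta>) * (x * k powr - \<gamma>)))
        = B * x * k powr - \<gamma>"
      by (simp add: B_def mult_ac)
    finally have card\<C>: "real (card \<C>) \<le> exp (B * x * k powr - \<gamma>)" .
    have small: "C \<subseteq> G \<and> real (card C) \<le> (1 - \<delta>') * real (card G)" if "C \<in> \<C>" for C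
    proof -
      have "C \<subseteq> G" "real (card C) \<le> (1 - \<delta>) * real (card G)"
        using \<C>(3) that by (auto simp: container_family_def)
      moreover have "(1 - \<delta>) * real (card G) \<le> (1 - \<delta>') * real (card G)"
        by (intro mult_right_mono) (auto simp: \<delta>'_def)
      ultimately show ?thesis by linarith
    qed
    have cover: "\<exists>C\<in>\<C>. I \<subseteq> C" if I: "I \<subseteq> G" "\<not> contains_copy ({1..n}, I) H" for I
    proof -
      \<comment> \<open>The weight lives on copies of \<open>H\<close>, so \<open>H\<close>-free
        means independent.\<close>
      have "\<forall>e\<subseteq>I. w e = 0" using w(2) I unfolding contains_copy_iff by blast
      then show ?thesis using \<C>(3) I(1) unfolding container_family_def by blast
    qed
    show ?thesis using \<C>(1) card\<C> small cover unfolding k_def x_def by blast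
  qed
  have \<delta>': "0 < \<delta>'" "\<delta>' < 1" using \<delta> by (auto simp: \<delta>'_def)
  have B: "0 \<le> B" using \<zeta> by (simp add: B_def)
  show ?thesis
    by (rule exI[of _ K], rule conjI[OF K0], rule exI[of _ \<delta>'], rule conjI[OF \<delta>'(1)],
        rule conjI[OF \<delta>'(2)], rule exI[of _ \<gamma>], rule conjI[OF \<gamma>], rule exI[of _ B],
        rule conjI[OF B], intro allI impI, rule main)
qed

section \<open>Trivial bounds and hypergraphs with at most one edge\<close>

lemma card_free_hypergraphs:
  "card (free_hypergraphs r n H) =
    card {I. I \<subseteq> {e. e \<subseteq> {1..n} \<and> card e = r} \<and> \<not> contains_copy ({1..n}, I) H}"
proof -
  let ?S = "{I. I \<subseteq> {e. e \<subseteq> {1..n} \<and> card e = r} \<and> \<not> contains_copy ({1..n}, I) H}"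
  have "bij_betw (Pair {1..n}) ?S (free_hypergraphs r n H)"
  proof (rule bij_betw_byWitness[where f' = snd])
    show "\<forall>G\<in>free_hypergraphs r n H. ({1..n}, edges G) = G"
      by (simp add: free_hypergraphs_def prod_eq_iff)
    show "Pair {1..n} ` ?S \<subseteq> free_hypergraphs r n H"
      unfolding free_hypergraphs_def uniform_hypergraph_def by clarsimp blast
    show "snd ` free_hypergraphs r n H \<subseteq> ?S"
    proof
      fix I assume "I \<in> snd ` free_hypergraphs r n H"
      then have "({1..n}, I) \<in> free_hypergraphs r n H"
        unfolding free_hypergraphs_def by clarsimp
      then show "I \<in> ?S"
        unfolding free_hypergraphs_def uniform_hypergraph_def by clarsimp
    qed
  qed simp
  then show ?thesis by (simp add: bij_betw_same_card)
qed

lemma card_free_hypergraphs_le: "card (free_hypergraphs r n H) \<le> 2 ^ (n ^ r)"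
proof -
  let ?U = "{e. e \<subseteq> {1..n} \<and> card e = r}"
  have "card (free_hypergraphs r n H) \<le> card (Pow ?U)"
    unfolding card_free_hypergraphs by (intro card_mono) auto
  also have "\<dots> = 2 ^ card ?U" by (simp add: card_Pow)
  also have "\<dots> \<le> 2 ^ (n ^ r)"
    using card_uniform_le[of ?U n r] by (intro power_increasing) auto
  finally show ?thesis .
qed

lemma card_free_hypergraphs_le_one:
  assumes "\<And>G. G \<in> free_hypergraphs r n H \<Longrightarrow> edges G = {}"
  shows "card (free_hypergraphs r n H) \<le> 1"
proof -
  have "free_hypergraphs r n H \<subseteq> {({1..n}, {})}"
  proof
    fix G assume G: "G \<in> free_hypergraphs r n H"
    then have "verts G = {1..n}" by (simp add: free_hypergraphs_def)
    then show "G \<in> {({1..n}, {})}" using assms[OF G] by (simp add: prod_eq_iff)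
  qed
  then have "card (free_hypergraphs r n H) \<le> card {({1..n}, {} :: nat set set)}"
    by (rule card_mono[rotated]) simp
  then show ?thesis by simp
qed

text \<open>The edge of \<open>H\<close>, if any, is mapped bijectively onto \<open>e'\<close>; the
  remaining vertices fit outside \<open>e'\<close> because \<open>G\<close> has at least as many
  vertices as \<open>H\<close>.\<close>

lemma contains_copy_single_edge:
  assumes H: "uniform_hypergraph r H" "card (edges H) \<le> 1" and G: "uniform_hypergraph r G"
    and le: "card (verts H) \<le> card (verts G)" and e': "e' \<in> edges G"
  shows "contains_copy G H"
proof -
  have fH: "finite (verts H)" and fG: "finite (verts G)"
    using H(1) G by (auto simp: uniform_hypergraph_def)
  show ?thesis
  proof (cases "edges H = {}")
    case True
    obtain f where "inj_on f (verts H)" "f ` verts H \<subseteq> verts G"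
      using card_le_inj[OF fH fG le] by blast
    then show ?thesis using True unfolding contains_copy_def by blast
  next
    case False
    then obtain e where e: "edges H = {e}"
    proof -
      have "card (edges H) \<noteq> 0" using False finite_edges[OF H(1)] by simp
      then have "card (edges H) = 1" using H(2) by linarith
      then show thesis using that by (rule card_1_singletonE)
    qed
    have eH: "e \<subseteq> verts H" "card e = r" using H(1) e by (auto simp: uniform_hypergraph_def)
    have eG: "e' \<subseteq> verts G" "card e' = r" using G e' by (auto simp: uniform_hypergraph_def)
    have fin: "finite e" "finite e'"
      using finite_subset[OF eH(1) fH] finite_subset[OF eG(1) fG] by simp_all
    obtain f where f: "bij_betw f e e'"
      using finite_same_card_bij[OF fin] eH eG by auto
    have "card (verts H - e) \<le> card (verts G - e')"
      using eH eG le fin by (simp add: card_Diff_subset)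
    then obtain g where g: "inj_on g (verts H - e)" "g ` (verts H - e) \<subseteq> verts G - e'"
      using card_le_inj[of "verts H - e" "verts G - e'"] fH fG by blast
    let ?F = "\<lambda>v. if v \<in> e then f v else g v"
    have "inj_on ?F (e \<union> (verts H - e))"
      using f g by (intro inj_on_disjoint_Un) (auto simp: bij_betw_def)
    moreover have "e \<union> (verts H - e) = verts H" using eH by blast
    moreover have "?F ` verts H \<subseteq> verts G" using f g eG by (auto simp: bij_betw_def)
    moreover have "?F ` e = e'" using f by (auto simp: bij_betw_def)
    ultimately show ?thesis
      unfolding contains_copy_def using e e' by (intro exI[of _ ?F]) auto
  qed
qed

theorem theorem1p7:
  fixes H :: "'a hypergraph" and r :: nat and \<alpha> A :: real
  assumes "uniform_hypergraph r H"
    and "\<alpha> > 0" and "A > 0"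
    and "ereal \<alpha> > ereal (real r) - 1 / ereal (r_density r H)"
    and "\<And>n. real (ex_num r n H) \<le> A * real n powr \<alpha>"
  shows "\<exists>C::real. \<forall>n. real (card (free_hypergraphs r n H)) \<le> 2 powr (C * real n powr \<alpha>)"
proof -
  \<comment> \<open>For \<open>n = 0\<close> the right-hand side is \<open>2 powr 0 = 1\<close>, because \<open>0 powr \<alpha> = 0\<close>.\<close>
  have zero: "card (free_hypergraphs r 0 H) \<le> 1"
  proof (rule card_free_hypergraphs_le_one)
    fix G assume "G \<in> free_hypergraphs r 0 H"
    then have G: "uniform_hypergraph r G" "verts G = {}" "\<not> contains_copy G H"
      by (simp_all add: free_hypergraphs_def)
    then have free: "\<not> contains_copy ({}, edges G) H" by (metis prod.collapse)
    \<comment> \<open>For \<open>r = 0\<close> the empty set may be an edge even on no vertices; the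
      hypothesis at \<open>n = 0\<close> excludes this for \<open>H\<close>-free
      hypergraphs.\<close>
    have "ex_num r 0 H = 0" using assms(5)[of 0] by simp
    then have "card (edges G) = 0"
      using card_le_ex_num[OF _ _ free, of r] G by (simp add: uniform_hypergraph_def)
    then show "edges G = {}" using finite_edges[OF G(1)] by simp
  qed
  have reduce: ?thesis
    if "\<And>n. 1 \<le> n \<Longrightarrow> real (card (free_hypergraphs r n H)) \<le> 2 powr (C * real n powr \<alpha>)" for C
  proof (intro exI[of _ C] allI)
    fix n show "real (card (free_hypergraphs r n H)) \<le> 2 powr (C * real n powr \<alpha>)"
      using that[of n] zero by (cases "n = 0") auto
  qed
  \<comment> \<open>The container argument requires \<open>r - \<alpha> > 0\<close> and a positive
    density, which two edges guarantee. The other two cases are elementary.\<close>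
  consider "real r \<le> \<alpha>" | "card (edges H) \<le> 1" | "\<alpha> < real r" "2 \<le> card (edges H)"
    by linarith
  then show ?thesis
  proof cases
    case 1
    show ?thesis
    proof (rule reduce[of 1])
      fix n :: nat assume n: "1 \<le> n"
      have "real (card (free_hypergraphs r n H)) \<le> 2 ^ (n ^ r)"
        using card_free_hypergraphs_le[of r n H] by (metis of_nat_le_iff of_nat_numeral of_nat_power)
      also have "\<dots> = 2 powr real (n ^ r)" by (simp only: powr_realpow zero_less_numeral)
      also have "real (n ^ r) = real n powr real r" using n by (simp add: powr_realpow)
      also have "2 powr (real n powr real r) \<le> 2 powr (1 * real n powr \<alpha>)"
        using n 1 by (simp add: powr_mono)
      finally show "real (card (free_hypergraphs r n H)) \<le> 2 powr (1 * real n powr \<alpha>)" .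
    qed
  next
    case 2
    define v where "v = card (verts H)"
    show ?thesis
    \<comment> \<open>For \<open>n < v\<close> the trivial bound is at most
      \<open>2 ^ (v ^ r)\<close>; for \<open>n \<ge> v\<close> any edge creates a copy, so at most
      the edgeless hypergraph remains.\<close>
    proof (rule reduce[of "real (v ^ r)"])
      fix n :: nat assume n: "1 \<le> n"
      have n\<alpha>: "1 \<le> real n powr \<alpha>" using n assms(2) by (intro ge_one_powr_ge_zero) auto
      show "real (card (free_hypergraphs r n H)) \<le> 2 powr (real (v ^ r) * real n powr \<alpha>)"
      proof (cases "v \<le> n")
        case True
        have "card (free_hypergraphs r n H) \<le> 1"
        proof (rule card_free_hypergraphs_le_one)
          fix G assume "G \<in> free_hypergraphs r n H"
          then have G: "uniform_hypergraph r G" "verts G = {1..n}" "\<not> contains_copy G H"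
            by (simp_all add: free_hypergraphs_def)
          then have "card (verts H) \<le> card (verts G)" using True by (simp add: v_def)
          then show "edges G = {}"
            using contains_copy_single_edge[OF assms(1) 2 G(1)] G(3) by blast
        qed
        moreover have "1 \<le> 2 powr (real (v ^ r) * real n powr \<alpha>)"
          by (intro ge_one_powr_ge_zero) auto
        ultimately show ?thesis by linarith
      next
        case False
        have "card (free_hypergraphs r n H) \<le> 2 ^ (n ^ r)" by (rule card_free_hypergraphs_le)
        also have "\<dots> \<le> 2 ^ (v ^ r)" using False by (intro power_increasing power_mono) auto
        finally have "real (card (free_hypergraphs r n H)) \<le> 2 ^ (v ^ r)"
          by (metis of_nat_le_iff of_nat_numeral of_nat_power)
        also have "\<dots> = 2 powr real (v ^ r)" by (simp only: powr_realpow zero_less_numeral)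
        also have "\<dots> \<le> 2 powr (real (v ^ r) * real n powr \<alpha>)"
          using mult_left_mono[OF n\<alpha>, of "real (v ^ r)"] by (intro powr_mono) auto
        finally show ?thesis .
      qed
    qed
  next
    case 3
    \<comment> \<open>Positive density makes the quotient finite, so the hypothesis becomes one
      about reals.\<close>
    have "0 < r_density r H" using r_density_bounds[OF assms(1) 3(2)] by simp
    then have dens: "real r - 1 / r_density r H < \<alpha>"
      using assms(4) by (simp add: one_ereal_def)
    obtain K \<delta> \<gamma> B where const: "0 < K" "0 < \<delta>" "\<delta> < 1" "0 < \<gamma>" "0 \<le> B"
      and step: "\<And>n G. 1 \<le> n \<Longrightarrow> (\<forall>e\<in>G. e \<subseteq> {1..n} \<and> card e = r) \<Longrightarrow>
        K * real n powr \<alpha> \<le> real (card G) \<Longrightarrow>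
        \<exists>\<C>. finite \<C> \<and>
          real (card \<C>) \<le> exp (B * real n powr \<alpha> * (real (card G) / real n powr \<alpha>) powr - \<gamma>) \<and>
          (\<forall>C\<in>\<C>. C \<subseteq> G \<and> real (card C) \<le> (1 - \<delta>) * real (card G)) \<and>
          (\<forall>I\<subseteq>G. \<not> contains_copy ({1..n}, I) H \<longrightarrow> (\<exists>C\<in>\<C>. I \<subseteq> C))"
      using containers_for_free_hypergraphs[OF assms(1) 3(2) assms(2) 3(1) dens assms(3,5)] by metis
    define D where "D = K + B / ((1 - \<delta>) powr - \<gamma> - 1) * ((1 - \<delta>) * K) powr - \<gamma>"
    show ?thesis
    \<comment> \<open>The divisor \<open>ln 2\<close> changes the base from \<open>e\<close> to
      \<open>2\<close>.\<close>
    proof (rule reduce[of "D / ln 2"])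
      fix n :: nat assume n: "1 \<le> n"
      let ?U = "{e. e \<subseteq> {1..n} \<and> card e = r}"
      have "real (card (free_hypergraphs r n H)) \<le> exp (real n powr \<alpha> * D)"
        unfolding card_free_hypergraphs D_def
      proof (rule card_subsets_le_by_containers[OF _ _ const])
        fix G assume "G \<subseteq> ?U" "K * real n powr \<alpha> \<le> real (card G)"
        then show "\<exists>\<C>. finite \<C> \<and>
          real (card \<C>) \<le> exp (B * real n powr \<alpha> * (real (card G) / real n powr \<alpha>) powr - \<gamma>) \<and>
          (\<forall>C\<in>\<C>. C \<subseteq> G \<and> real (card C) \<le> (1 - \<delta>) * real (card G)) \<and>
          (\<forall>I\<subseteq>G. \<not> contains_copy ({1..n}, I) H \<longrightarrow> (\<exists>C\<in>\<C>. I \<subseteq> C))"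
          by (intro step[OF n]) auto
      qed (use n in auto)
      also have "\<dots> = 2 powr (D / ln 2 * real n powr \<alpha>)"
        by (simp add: powr_def mult.commute)
      finally show "real (card (free_hypergraphs r n H)) \<le> 2 powr (D / ln 2 * real n powr \<alpha>)" .
    qed
  qed
qed

end
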